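(* Let $H$ be a quaternion algebra over an algebraic number field $K$ with orthogonal involution $\sigma$. If $\mathcal{O}$ is an order of $H$ and a $\sigma$-Euclidean ring, then $\mathcal{O}$ has right class number $1$.
   Context: An involution on a ring $R$ is a map $\sigma:R\to R$ with $\sigma(x+y)=\sigma(x)+\sigma(y)$, $\sigma(xy)=\sigma(y)\sigma(x)$ and $\sigma(\sigma(x))=x$ for all $x,y\in R$; write $R^+=\{r\in R\mid \sigma(r)=r\}$. $\sigma$-Euclidean ring: let $(R,\sigma)$ be a ring with involution and without zero divisors. $R$ is $\sigma$-Euclidean if there exist a well-ordered set $W$ and a function $\Phi:R\to W$ (a stathm) such that for all $a,b\in R$ with $b\neq 0$ and $a\sigma(b)\in R^+$, there exists $q\in R^+$ with $\Phi(a-bq)<\Phi(b)$. Saying that an order $\mathcal{O}\subset H$ is a $\sigma$-Euclidean ring means that $\mathcal{O}$ is closed under $\sigma$ and that $(\mathcal{O},\sigma|_{\mathcal{O}})$ is $\sigma$-Euclidean. An orthogonal involution on a quaternion algebra $H$ over $K$ is a $K$-linear involution of $H$ different from quaternion conjugation $z\mapsto\overline{z}$; these are the maps $z\mapsto u\overline{z}u^{-1}$ with $u\in H^\times\setminus K^\times$, $u^2\in K$. Let $\mathfrak{o}_K$ be the ring of integers of $K$. An order of $H$ is a subring $\mathcal{O}\subset H$ that is a finitely generated $\mathfrak{o}_K$-module with $K\mathcal{O}=H$. A right fractional $\mathcal{O}$-ideal is a finitely generated $\mathfrak{o}_K$-submodule $I\subset H$ with $KI=H$ and $I\mathcal{O}\subset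 I$; it is invertible if and only if it is locally principal (for every prime $\mathfrak{p}$, $I_\mathfrak{p}=x_\mathfrak{p}\mathcal{O}_\mathfrak{p}$ for some $x_\mathfrak{p}\in H_\mathfrak{p}^\times$). Two invertible right fractional $\mathcal{O}$-ideals $I,J$ are equivalent if $\alpha I=J$ for some $\alpha\in H^\times$. The right class number of $\mathcal{O}$ is the number of equivalence classes. *)

theory Defs
  imports "HOL-Algebra.Algebraic_Closure_Type" "HOL-Algebra.Subrings"
begin

definition number_field :: "'k::field_char_0 itself \<Rightarrow> bool" where
  "number_field TYPE('k) \<longleftrightarrow>
     (\<exists>B. finite_dimensional_vector_space (\<lambda>(q::rat) (x::'k). of_rat q * x) B)"

definition integers_of :: "'k::field_char_0 itself \<Rightarrow> 'k ring" where
  "integers_of TYPE('k) = ring_of_type_algebra\<lparr>carrier := {x. algebraic_int x}\<rparr>"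

text \<open>
  The quaternion algebra \<open>(a, b | K)\<close> with its standard generators \<open>i\<close> and \<open>j\<close>, for a
  field \<open>K\<close> of characteristic other than two. The split case (matrices) is included.
\<close>

locale quaternion_algebra = vector_space scale
  for scale :: "'k::field_char_0 \<Rightarrow> 'h::ring_1 \<Rightarrow> 'h" +
  fixes a b :: 'k and i j :: 'h
  assumes scale_mult_left: "scale c x * y = scale c (x * y)"
    and scale_mult_right: "x * scale c y = scale c (x * y)"
    and a_nonzero: "a \<noteq> 0"
    and b_nonzero: "b \<noteq> 0"
    and i_square: "i * i = scale a 1"
    and j_square: "j * j = scale b 1"
    and anticommute: "j * i = - (i * j)"
    and distinct_basis: "distinct [1, i, j, i * j]"
    and independent_basis: "independent {1, i, j, i * j}"
    and span_basis: "span {1, i, j, i * j} = UNIV"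

definition quaternion_conj ::
  "('k::field_char_0 \<Rightarrow> 'h::ring_1 \<Rightarrow> 'h) \<Rightarrow> 'h \<Rightarrow> 'h \<Rightarrow> 'h \<Rightarrow> 'h" where
  "quaternion_conj scale i j z =
     (let coord = module.representation scale {1, i, j, i * j} z
      in scale (coord 1) 1 - scale (coord i) i - scale (coord j) j
         - scale (coord (i * j)) (i * j))"

definition involution_on :: "'h::ring_1 set \<Rightarrow> ('h \<Rightarrow> 'h) \<Rightarrow> bool" where
  "involution_on R \<sigma> \<longleftrightarrow>
     \<sigma> \<in> R \<rightarrow> R \<and>
     (\<forall>x\<in>R. \<forall>y\<in>R. \<sigma> (x + y) = \<sigma> x + \<sigma> y \<and> \<sigma> (x * y) = \<sigma> y * \<sigma> x) \<and>
     (\<forall>x\<in>R. \<sigma> (\<sigma> x) = x)"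

definition symmetric_elements :: "'h set \<Rightarrow> ('h \<Rightarrow> 'h) \<Rightarrow> 'h set" where
  "symmetric_elements R \<sigma> = {r \<in> R. \<sigma> r = r}"

definition orthogonal_involution ::
  "('k::field_char_0 \<Rightarrow> 'h::ring_1 \<Rightarrow> 'h) \<Rightarrow> 'h \<Rightarrow> 'h \<Rightarrow> ('h \<Rightarrow> 'h) \<Rightarrow> bool" where
  "orthogonal_involution scale i j \<sigma> \<longleftrightarrow>
     involution_on UNIV \<sigma> \<and> Vector_Spaces.linear scale scale \<sigma> \<and>
     \<sigma> \<noteq> quaternion_conj scale i j"

text \<open>
  HOL cannot quantify over types inside a formula, so the type containing the well-ordered set
  \<open>W\<close> is a parameter. A hypothesis \<open>sigma_Euclidean TYPE('w) R \<sigma>\<close> with \<open>'w\<close> a type variable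
  allows arbitrary \<open>W\<close>.
\<close>

definition sigma_Euclidean :: "'w itself \<Rightarrow> 'h::ring_1 set \<Rightarrow> ('h \<Rightarrow> 'h) \<Rightarrow> bool" where
  "sigma_Euclidean TYPE('w) R \<sigma> \<longleftrightarrow>
     involution_on R \<sigma> \<and>
     (\<forall>x\<in>R. \<forall>y\<in>R. x * y = 0 \<longrightarrow> x = 0 \<or> y = 0) \<and>
     (\<exists>(W::'w set) le \<Phi>. well_order_on W le \<and> \<Phi> \<in> R \<rightarrow> W \<and>
        (\<forall>a\<in>R. \<forall>b\<in>R. b \<noteq> 0 \<and> a * \<sigma> b \<in> symmetric_elements R \<sigma> \<longrightarrow>
           (\<exists>q\<in>symmetric_elements R \<sigma>. (\<Phi> (a - b * q), \<Phi> b) \<in> le - Id)))"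

definition fin_gen_integral_submodule ::
  "('k::field_char_0 \<Rightarrow> 'h::ring_1 \<Rightarrow> 'h) \<Rightarrow> 'h set \<Rightarrow> bool" where
  "fin_gen_integral_submodule scale M \<longleftrightarrow>
     (\<exists>S. finite S \<and>
        M = {\<Sum>s\<in>S. scale (c s) s | c. \<forall>s\<in>S. c s \<in> carrier (integers_of TYPE('k))})"

definition quaternion_order ::
  "('k::field_char_0 \<Rightarrow> 'h::ring_1 \<Rightarrow> 'h) \<Rightarrow> 'h set \<Rightarrow> bool" where
  "quaternion_order scale \<O> \<longleftrightarrow>
     subring \<O> ring_of_type_algebra \<and> fin_gen_integral_submodule scale \<O> \<and>
     module.span scale \<O> = UNIV"

definition right_fractional_ideal ::
  "('k::field_char_0 \<Rightarrow> 'h::ring_1 \<Rightarrow> 'h) \<Rightarrow> 'h set \<Rightarrow> 'h set \<Rightarrow> bool" where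
  "right_fractional_ideal scale \<O> I \<longleftrightarrow>
     fin_gen_integral_submodule scale I \<and> module.span scale I = UNIV \<and>
     (\<forall>x\<in>I. \<forall>y\<in>\<O>. x * y \<in> I)"

text \<open>The localization of a submodule \<open>M\<close> of \<open>H\<close> at \<open>P\<close>, formed inside \<open>H\<close>.\<close>

definition localize ::
  "('k::field_char_0 \<Rightarrow> 'h::ring_1 \<Rightarrow> 'h) \<Rightarrow> 'k set \<Rightarrow> 'h set \<Rightarrow> 'h set" where
  "localize scale P M =
     {scale (inverse s) x | s x. s \<in> carrier (integers_of TYPE('k)) - P \<and> x \<in> M}"

text \<open>
  At \<open>P = {0}\<close> local principality is automatic, since both localizations are all of \<open>H\<close>.
\<close>

definition locally_principal ::
  "('k::field_char_0 \<Rightarrow> 'h::ring_1 \<Rightarrow> 'h) \<Rightarrow> 'h set \<Rightarrow> 'h set \<Rightarrow> bool" where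
  "locally_principal scale \<O> I \<longleftrightarrow>
     (\<forall>P. primeideal P (integers_of TYPE('k)) \<and> P \<noteq> {0} \<longrightarrow>
        (\<exists>x\<in>Units ring_of_type_algebra. localize scale P I = (*) x ` localize scale P \<O>))"

definition invertible_right_ideals ::
  "('k::field_char_0 \<Rightarrow> 'h::ring_1 \<Rightarrow> 'h) \<Rightarrow> 'h set \<Rightarrow> 'h set set" where
  "invertible_right_ideals scale \<O> =
     {I. right_fractional_ideal scale \<O> I \<and> locally_principal scale \<O> I}"

definition right_ideal_equiv ::
  "('k::field_char_0 \<Rightarrow> 'h::ring_1 \<Rightarrow> 'h) \<Rightarrow> 'h set \<Rightarrow> 'h set rel" where
  "right_ideal_equiv scale \<O> =
     {(I, J). I \<in> invertible_right_ideals scale \<O> \<and> J \<in> invertible_right_ideals scale \<O> \<and>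
        (\<exists>\<alpha>\<in>Units ring_of_type_algebra. (*) \<alpha> ` I = J)}"

definition right_class_number ::
  "('k::field_char_0 \<Rightarrow> 'h::ring_1 \<Rightarrow> 'h) \<Rightarrow> 'h set \<Rightarrow> nat" where
  "right_class_number scale \<O> =
     card (invertible_right_ideals scale \<O> // right_ideal_equiv scale \<O>)"

end

theory Submission
  imports Defs "Jordan_Normal_Form.Char_Poly"
begin

text \<open>
  Let \<open>a, b \<in> \<O>\<close> with \<open>a \<sigma>(b)\<close> symmetric. The \<open>\<sigma>\<close>-Euclidean condition permits the Euclidean
  algorithm for \<open>a\<close> and \<open>b\<close>, because this condition is inherited by \<open>b\<close> and the remainder \<open>a - b q\<close>.
  So \<open>a \<O> + b \<O>\<close> is principal (\<open>sigma_Euclidean_two_generators\<close>). In particular this holds if \<open>a\<close>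
  is symmetric and \<open>b\<close> is an integer. It remains to show that every invertible right ideal \<open>I\<close> is
  equivalent to an ideal \<open>s \<O> + n \<O>\<close> with \<open>s\<close> symmetric and \<open>n\<close> a positive integer
  (\<open>symmetric_two_generators\<close>).

  Since \<open>\<O>\<close> has no zero divisors, \<open>H\<close> is a division algebra. For every \<open>x \<in> H\<close> there is a nonzero
  symmetric \<open>t\<close> such that \<open>t x\<close> is symmetric too (\<open>symmetric_multiplier\<close>). Let \<open>x\<close> generate \<open>I\<close> at
  all primes that divide an integer \<open>m\<close> such that \<open>I\<close> is generated by an integer \<open>E\<close> at all other
  primes. Then the ideal \<open>t I\<close> is generated by one of the symmetric elements \<open>t x\<close> and \<open>t E\<close> at each
  prime. As the symmetric elements are a \<open>K\<close>-subspace, approximation gives a single symmetric \<open>s\<close>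
  that generates \<open>t I\<close> at all primes that divide a given positive integer \<open>n \<in> t I\<close>. Multiplying
  \<open>t\<close> by an integer achieves \<open>t I \<subseteq> \<O>\<close>, and then \<open>t I = s \<O> + n \<O>\<close>.

  The approximation needs no factorization of ideals. Some power \<open>e\<close> of an algebraic integer is
  idempotent modulo a given integer (\<open>algebraic_int_idempotent_power\<close>), and two local generators
  \<open>x\<close>, \<open>x'\<close> are combined to \<open>e x + (1 - e) x'\<close> (\<open>glue_generators\<close>).
\<close>


section \<open>Algebraic integers\<close>

text \<open>The field \<open>K\<close> as a \<open>\<int>\<close>-module.\<close>

interpretation int_mod: Modules.module "\<lambda>(n::int) (x::'k::field_char_0). of_int n * x"
  by unfold_locales (auto simp: algebra_simps)

text \<open>Such a \<open>z\<close> is an eigenvalue of an integer matrix, whose characteristic polynomial is monic.\<close>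

lemma algebraic_int_if_eigenvalue:
  fixes z :: "'k::field_char_0" and v :: "nat \<Rightarrow> 'k" and A :: "nat \<Rightarrow> nat \<Rightarrow> int"
  assumes "m < n" "v m \<noteq> 0"
    and eq: "\<And>k. k < n \<Longrightarrow> z * v k = (\<Sum>l<n. of_int (A k l) * v l)"
  shows "algebraic_int z"
proof -
  define M where "M = mat n n (\<lambda>(k, l). A k l)"
  have M: "M \<in> carrier_mat n n" by (simp add: M_def)
  let ?M = "map_mat of_int M :: 'k mat"
  have M': "?M \<in> carrier_mat n n" using M by simp
  have "?M *\<^sub>v vec n v = z \<cdot>\<^sub>v vec n v"
    by (rule eq_vecI) (auto simp: M_def scalar_prod_def eq atLeast0LessThan)
  moreover have "vec n v \<noteq> 0\<^sub>v n"
    using assms(1,2) by (metis index_vec index_zero_vec(1))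
  ultimately have "eigenvalue ?M z"
    using M' unfolding eigenvalue_def eigenvector_def by (intro exI[of _ "vec n v"]) auto
  then have "poly (char_poly ?M) z = 0"
    using eigenvalue_root_char_poly[OF M'] by simp
  then have "poly (map_poly of_int (char_poly M)) z = 0"
    by (simp add: of_int_hom.char_poly_hom[OF M])
  moreover have "lead_coeff (char_poly M) = 1"
    using degree_monic_char_poly[OF M] by simp
  ultimately show ?thesis
    unfolding algebraic_int_altdef_ipoly by blast
qed

lemma algebraic_int_if_stable:
  fixes z :: "'k::field_char_0"
  assumes "finite V" "v \<in> V" "v \<noteq> 0"
    and stable: "\<And>w. w \<in> V \<Longrightarrow> z * w \<in> int_mod.span V"
  shows "algebraic_int z"
proof -
  obtain f where f: "bij_betw f {..<card V} V"
    using ex_bij_betw_nat_finite[OF \<open>finite V\<close>] by (auto simp: atLeast0LessThan)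
  obtain m where m: "m < card V" "f m = v"
    using f \<open>v \<in> V\<close> by (metis bij_betw_imp_surj_on imageE lessThan_iff)
  have "\<exists>c. z * w = (\<Sum>u\<in>V. of_int (c u) * u)" if "w \<in> V" for w
    using stable[OF that] int_mod.span_finite[OF \<open>finite V\<close>] by auto
  then obtain C where C: "\<And>w. w \<in> V \<Longrightarrow> z * w = (\<Sum>u\<in>V. of_int (C w u) * u)"
    by metis
  have "z * f k = (\<Sum>l<card V. of_int (C (f k) (f l)) * f l)" if "k < card V" for k
    using C[of "f k"] that f sum.reindex_bij_betw[OF f, of "\<lambda>u. of_int (C (f k) u) * u"]
    by (auto simp: bij_betw_def)
  then show ?thesis
    using algebraic_int_if_eigenvalue[of m "card V" f z "\<lambda>k l. C (f k) (f l)"] m assms by simp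
qed

lemma int_span_mult_closed:
  fixes x :: "'k::field_char_0"
  assumes "\<And>w. w \<in> V \<Longrightarrow> x * w \<in> int_mod.span V" "u \<in> int_mod.span V"
  shows "x * u \<in> int_mod.span V"
  using assms(2)
proof (induction rule: int_mod.span_induct_alt)
  case base
  then show ?case by (simp add: int_mod.span_zero)
next
  case (step c w y)
  have "x * (of_int c * w + y) = of_int c * (x * w) + x * y"
    by (simp add: algebra_simps)
  then show ?case
    using step assms(1) int_mod.span_add int_mod.span_scale by metis
qed

lemma algebraic_int_power_in_span:
  fixes x :: "'k::field_char_0"
  assumes "algebraic_int x"
  obtains m where "m > 0" "x ^ m \<in> int_mod.span ((\<lambda>r. x ^ r) ` {..<m})"
proof -
  obtain p :: "int poly" where p: "poly (map_poly of_int p) x = 0" "lead_coeff p = 1"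
    using assms algebraic_int_altdef_ipoly by blast
  have deg: "degree p > 0"
  proof (rule ccontr)
    assume "\<not> degree p > 0"
    then obtain c where "p = [:c:]" by (metis degree_eq_zeroE gr0I)
    with p show False by auto
  qed
  have "poly (map_poly of_int p) x = (\<Sum>r\<le>degree p. of_int (coeff p r) * x ^ r)"
    by (simp add: poly_altdef degree_map_poly coeff_map_poly)
  also have "\<dots> = (\<Sum>r<degree p. of_int (coeff p r) * x ^ r) + x ^ degree p"
    using p(2) by (simp add: lessThan_Suc_atMost[symmetric])
  finally have "x ^ degree p = - (\<Sum>r<degree p. of_int (coeff p r) * x ^ r)"
    using p(1) by (simp add: add_eq_0_iff)
  also have "\<dots> \<in> int_mod.span ((\<lambda>r. x ^ r) ` {..<degree p})"
    by (intro int_mod.span_neg int_mod.span_sum int_mod.span_scale int_mod.span_base) auto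
  finally show ?thesis using that deg by blast
qed

lemma
  fixes x y :: "'k::field_char_0"
  assumes x: "algebraic_int x" and y: "algebraic_int y"
  shows algebraic_int_add: "algebraic_int (x + y)"
    and algebraic_int_mult: "algebraic_int (x * y)"
proof -
  obtain m where m: "m > 0" "x ^ m \<in> int_mod.span ((\<lambda>r. x ^ r) ` {..<m})"
    using algebraic_int_power_in_span[OF x] by blast
  obtain n where n: "n > 0" "y ^ n \<in> int_mod.span ((\<lambda>r. y ^ r) ` {..<n})"
    using algebraic_int_power_in_span[OF y] by blast
  define V where "V = (\<lambda>(r, s). x ^ r * y ^ s) ` ({..<m} \<times> {..<n})"
  have V: "x ^ r * y ^ s \<in> int_mod.span V" if "r < m" "s < n" for r s
    using that by (auto simp: V_def intro!: int_mod.span_base)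
  have xV: "u * y ^ s \<in> int_mod.span V"
    if "u \<in> int_mod.span ((\<lambda>r. x ^ r) ` {..<m})" "s < n" for u s
    using that(1)
  proof (induction rule: int_mod.span_induct_alt)
    case base
    then show ?case by (simp add: int_mod.span_zero)
  next
    case (step c w u)
    have "(of_int c * w + u) * y ^ s = of_int c * (w * y ^ s) + u * y ^ s"
      by (simp add: algebra_simps)
    moreover have "w * y ^ s \<in> int_mod.span V" using step.hyps V that(2) by auto
    ultimately show ?case
      using int_mod.span_add[OF int_mod.span_scale step.IH] by simp
  qed
  have yV: "x ^ r * u \<in> int_mod.span V"
    if "u \<in> int_mod.span ((\<lambda>r. y ^ r) ` {..<n})" "r < m" for u r
    using that(1)
  proof (induction rule: int_mod.span_induct_alt)
    case base
    then show ?case by (simp add: int_mod.span_zero)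
  next
    case (step c w u)
    have "x ^ r * (of_int c * w + u) = of_int c * (x ^ r * w) + x ^ r * u"
      by (simp add: algebra_simps)
    moreover have "x ^ r * w \<in> int_mod.span V" using step.hyps V that(2) by auto
    ultimately show ?case
      using int_mod.span_add[OF int_mod.span_scale step.IH] by simp
  qed
  have xst: "x * w \<in> int_mod.span V" if "w \<in> V" for w
  proof -
    obtain r s where w: "w = x ^ r * y ^ s" "r < m" "s < n" using \<open>w \<in> V\<close> by (auto simp: V_def)
    have "x ^ Suc r * y ^ s \<in> int_mod.span V"
    proof (cases "Suc r < m")
      case True
      then show ?thesis using V w by blast
    next
      case False
      then have "Suc r = m" using w by simp
      then show ?thesis using xV[OF m(2) w(3)] by simp
    qed
    then show ?thesis by (simp add: w algebra_simps)
  qed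
  have yst: "y * w \<in> int_mod.span V" if "w \<in> V" for w
  proof -
    obtain r s where w: "w = x ^ r * y ^ s" "r < m" "s < n" using \<open>w \<in> V\<close> by (auto simp: V_def)
    have "x ^ r * y ^ Suc s \<in> int_mod.span V"
    proof (cases "Suc s < n")
      case True
      then show ?thesis using V w by blast
    next
      case False
      then have "Suc s = n" using w by simp
      then show ?thesis using yV[OF n(2) w(2)] by simp
    qed
    then show ?thesis by (simp add: w algebra_simps)
  qed
  have fin: "finite V" and one: "1 \<in> V"
    using m(1) n(1) by (auto simp: V_def intro!: image_eqI[of _ _ "(0, 0)"])
  show "algebraic_int (x + y)"
    using algebraic_int_if_stable[OF fin one one_neq_zero, of "x + y"]
    by (simp add: distrib_right int_mod.span_add xst yst)
  show "algebraic_int (x * y)"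
    using algebraic_int_if_stable[OF fin one one_neq_zero, of "x * y"] int_span_mult_closed[OF xst yst]
    by (simp add: mult.assoc)
qed

lemma algebraic_int_diff:
  fixes x y :: "'k::field_char_0"
  assumes "algebraic_int x" "algebraic_int y"
  shows "algebraic_int (x - y)"
  using algebraic_int_add[of x "- y"] assms by simp

lemma algebraic_int_power:
  fixes x :: "'k::field_char_0"
  assumes "algebraic_int x"
  shows "algebraic_int (x ^ n)"
  by (induction n) (auto intro: algebraic_int_mult assms)

lemma algebraic_int_span:
  fixes u :: "'k::field_char_0"
  assumes "\<And>w. w \<in> V \<Longrightarrow> algebraic_int w" "u \<in> int_mod.span V"
  shows "algebraic_int u"
  using assms(2)
  by (induction rule: int_mod.span_induct_alt)
    (auto intro: algebraic_int_add algebraic_int_mult assms(1))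

text \<open>Every element of a number field has a positive integer as a denominator.\<close>

lemma number_field_denominator:
  fixes x :: "'k::field_char_0"
  assumes "number_field TYPE('k)"
  obtains n :: nat where "n > 0" "algebraic_int (of_nat n * x)"
proof -
  obtain B where "finite_dimensional_vector_space (\<lambda>(q::rat) (x::'k). of_rat q * x) B"
    using assms unfolding number_field_def by blast
  then interpret Q: finite_dimensional_vector_space "\<lambda>(q::rat) (x::'k). of_rat q * x" B .
  have clear: "\<exists>n::nat. n > 0 \<and> of_nat n * y \<in> int_mod.span B" for y
  proof -
    have "y \<in> Q.span B" by (simp add: Q.span_Basis)
    then show ?thesis
    proof (induction rule: Q.span_induct_alt)
      case base
      then show ?case by (auto intro!: exI[of _ 1] simp: int_mod.span_zero)
    next
      case (step c w y)
      then obtain n :: nat where n: "n > 0" "of_nat n * y \<in> int_mod.span B" by blast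
      obtain p q where c: "quotient_of c = (p, q)" by (cases "quotient_of c")
      have q: "q > 0" using quotient_of_denom_pos[OF c] .
      have pq: "of_int q * (of_rat c :: 'k) = of_int p"
        using quotient_of_div[OF c] q by (simp add: of_rat_divide)
      have "of_nat (nat q * n) * (of_rat c * w + y)
          = of_int (int n * p) * w + of_int q * (of_nat n * y)"
        using q by (simp add: algebra_simps pq[symmetric])
      moreover have "\<dots> \<in> int_mod.span B"
        using n(2) step.hyps
        by (intro int_mod.span_add int_mod.span_scale[OF int_mod.span_base] int_mod.span_scale[OF n(2)])
      ultimately show ?case using n(1) q
        by (metis nat_0_less_mult_iff zero_less_nat_eq)
    qed
  qed
  then obtain d :: "'k \<Rightarrow> nat"
    where d: "\<And>y. d y > 0" "\<And>y. of_nat (d y) * y \<in> int_mod.span B" by metis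
  \<comment> \<open>Multiplication by \<open>n x\<close> has an integer matrix with respect to \<open>B\<close>.\<close>
  define n where "n = (\<Prod>w\<in>B. d (x * w))"
  have "n > 0" unfolding n_def using d(1) by (simp add: prod_pos)
  obtain v where v: "v \<in> B" "v \<noteq> 0"
  proof (rule ccontr)
    assume "\<not> thesis"
    then have "B \<subseteq> {0}" using that by blast
    then have "Q.span B \<subseteq> {0}" using Q.span_mono[of B "{0}"] by simp
    then show False using Q.span_Basis by (metis UNIV_I singletonD subsetD zero_neq_one)
  qed
  have "of_nat n * x * w \<in> int_mod.span B" if "w \<in> B" for w
  proof -
    have "n = (\<Prod>u\<in>B - {w}. d (x * u)) * d (x * w)"
      unfolding n_def using that Q.finite_Basis by (simp add: prod.remove mult.commute)
    then have "of_nat n * x * w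
        = of_int (int (\<Prod>u\<in>B - {w}. d (x * u))) * (of_nat (d (x * w)) * (x * w))"
      by (simp only: of_nat_mult of_int_of_nat_eq mult.assoc)
    then show ?thesis using int_mod.span_scale d(2) by metis
  qed
  then have "algebraic_int (of_nat n * x)"
    using algebraic_int_if_stable[OF Q.finite_Basis v] by blast
  then show ?thesis using that \<open>n > 0\<close> by blast
qed

text \<open>Pigeonhole principle: the powers of \<open>s\<close> lie in finitely many residue classes modulo \<open>N\<close>.\<close>

lemma algebraic_int_powers_congruent:
  fixes s :: "'k::field_char_0"
  assumes s: "algebraic_int s" and "N > 0"
  obtains m n r where "m < n" "algebraic_int r" "s ^ n - s ^ m = of_nat N * r"
proof -
  obtain d where d: "d > 0" "s ^ d \<in> int_mod.span ((\<lambda>r. s ^ r) ` {..<d})"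
    using algebraic_int_power_in_span[OF s] by blast
  define V where "V = (\<lambda>r. s ^ r) ` {..<d}"
  have fin: "finite V" and one: "1 \<in> V" using d(1) by (auto simp: V_def image_iff intro!: bexI[of _ 0])
  have st: "s * w \<in> int_mod.span V" if "w \<in> V" for w
  proof -
    obtain r where r: "w = s ^ r" "r < d" using \<open>w \<in> V\<close> by (auto simp: V_def)
    have "s ^ Suc r \<in> int_mod.span V"
    proof (cases "Suc r < d")
      case True
      then show ?thesis unfolding V_def by (intro int_mod.span_base) blast
    next
      case False
      then have "Suc r = d" using r by simp
      then show ?thesis using d by (simp add: V_def)
    qed
    then show ?thesis by (simp add: r)
  qed
  have pow: "s ^ n \<in> int_mod.span V" for n
    by (induction n) (auto intro: int_mod.span_base one int_span_mult_closed st)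
  \<comment> \<open>\<open>F\<close> contains representatives of the finitely many classes of \<open>span V\<close> modulo \<open>N\<close>.\<close>
  define F where "F = (\<lambda>c. \<Sum>v\<in>V. of_int (c v) * v) ` (PiE V (\<lambda>_. {0..<int N}))"
  have "finite F" unfolding F_def using fin by (intro finite_imageI finite_PiE) auto
  have "\<exists>f\<in>F. \<exists>w\<in>int_mod.span V. s ^ n = f + of_nat N * w" for n
  proof -
    obtain c where c: "s ^ n = (\<Sum>v\<in>V. of_int (c v) * v)"
      using pow[of n] int_mod.span_finite[OF fin] by auto
    have "s ^ n = (\<Sum>v\<in>V. of_int (c v mod N) * v + of_int N * (of_int (c v div N) * v))"
      unfolding c
    proof (rule sum.cong[OF refl])
      fix v
      have "(of_int (c v) :: 'k) = of_int (int N * (c v div int N) + c v mod int N)"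
        by simp
      then show "of_int (c v) * v = of_int (c v mod int N) * v
          + of_int (int N) * (of_int (c v div int N) * v)"
        by (simp only: of_int_add of_int_mult algebra_simps)
    qed
    also have "\<dots> = (\<Sum>v\<in>V. of_int (restrict (\<lambda>v. c v mod N) V v) * v)
        + of_nat N * (\<Sum>v\<in>V. of_int (c v div N) * v)"
      by (simp add: sum.distrib sum_distrib_left)
    finally have "s ^ n = (\<Sum>v\<in>V. of_int (restrict (\<lambda>v. c v mod N) V v) * v)
        + of_nat N * (\<Sum>v\<in>V. of_int (c v div N) * v)" .
    moreover have "(\<Sum>v\<in>V. of_int (restrict (\<lambda>v. c v mod N) V v) * v) \<in> F"
      unfolding F_def using \<open>N > 0\<close> by (intro imageI) auto
    moreover have "(\<Sum>v\<in>V. of_int (c v div N) * v) \<in> int_mod.span V"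
      by (intro int_mod.span_sum int_mod.span_scale int_mod.span_base)
    ultimately show ?thesis by blast
  qed
  then obtain f w where f: "\<And>n. f n \<in> F" and w: "\<And>n. w n \<in> int_mod.span V"
    and fw: "\<And>n. s ^ n = f n + of_nat N * w n"
    by metis
  have "finite (range f)" using f \<open>finite F\<close> by (auto intro: finite_subset)
  then have "\<not> inj f" using finite_imageD infinite_UNIV_nat by blast
  then obtain m n where mn: "m < n" "f m = f n"
    unfolding inj_def by (metis linorder_neqE_nat)
  have alg: "algebraic_int u" if "u \<in> V" for u
    using that s by (auto simp: V_def intro: algebraic_int_power)
  have "s ^ n - s ^ m = of_nat N * (w n - w m)"
    using mn(2) by (simp add: fw[of m] fw[of n] algebra_simps)
  moreover have "algebraic_int (w n - w m)"
    using algebraic_int_span[OF alg int_mod.span_diff[OF w w]] by blast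
  ultimately show ?thesis using that mn(1) by blast
qed

text \<open>
  Since \<open>\<int>[s] / N\<int>[s]\<close> is finite, some power of \<open>s\<close> is idempotent modulo \<open>N\<close>. Such idempotents
  take the place of the Chinese remainder theorem for the prime ideals that divide \<open>N\<close>.
\<close>

lemma algebraic_int_idempotent_power:
  fixes s :: "'k::field_char_0"
  assumes s: "algebraic_int s" and "N > 0"
  obtains k r where "k > 0" "algebraic_int r" "s ^ k * s ^ k - s ^ k = of_nat N * r"
proof -
  obtain m n r where mn: "m < n" "algebraic_int r" "s ^ n - s ^ m = of_nat N * r"
    using algebraic_int_powers_congruent[OF assms] by blast
  define c where "c = n - m"
  have *: "\<exists>r. algebraic_int r \<and> s ^ (m + u + v * c) - s ^ (m + u) = of_nat N * r" for u v
  proof (induction v)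
    case 0
    then show ?case by (intro exI[of _ 0]) simp
  next
    case (Suc v)
    then obtain r' where r': "algebraic_int r'"
      "s ^ (m + u + v * c) - s ^ (m + u) = of_nat N * r'" by blast
    have "m + u + Suc v * c = n + (u + v * c)" using mn(1) by (simp add: c_def)
    then have "s ^ (m + u + Suc v * c) - s ^ (m + u + v * c) = (s ^ n - s ^ m) * s ^ (u + v * c)"
      by (simp only: power_add algebra_simps)
    then have "s ^ (m + u + Suc v * c) - s ^ (m + u) = of_nat N * (r * s ^ (u + v * c) + r')"
      using r'(2) mn(3) by (simp add: algebra_simps)
    then show ?case
      using mn(2) r'(1) s algebraic_int_add algebraic_int_mult algebraic_int_power by metis
  qed
  \<comment> \<open>From the exponent \<open>m\<close> on, the powers have period \<open>c\<close> modulo \<open>N\<close>; this \<open>k\<close> is a multiple of \<open>c\<close>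
    and at least \<open>m\<close>.\<close>
  define k where "k = c * (m + 1)"
  have "c \<ge> 1" using mn(1) by (simp add: c_def)
  then have "k \<ge> 1 * (m + 1)" unfolding k_def by (rule mult_le_mono1)
  then have k: "k > 0" "k \<ge> m" by simp_all
  obtain r' where "algebraic_int r'" "s ^ (m + (k - m) + (m + 1) * c) - s ^ (m + (k - m)) = of_nat N * r'"
    using * by blast
  moreover have "m + (k - m) + (m + 1) * c = k + k" "m + (k - m) = k"
    using k by (simp_all add: k_def mult.commute)
  ultimately have "algebraic_int r'" "s ^ (k + k) - s ^ k = of_nat N * r'"
    by simp_all
  then have "algebraic_int r'" "s ^ k * s ^ k - s ^ k = of_nat N * r'"
    by (simp_all only: power_add)
  then show ?thesis using that k(1) by blast
qed

lemma carrier_integers_of [simp]: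
  "carrier (integers_of TYPE('k::field_char_0)) = {x. algebraic_int x}"
  by (simp add: integers_of_def)

lemma integers_of_simps [simp]:
  "x \<otimes>\<^bsub>integers_of TYPE('k::field_char_0)\<^esub> y = x * (y::'k)"
  "x \<oplus>\<^bsub>integers_of TYPE('k)\<^esub> y = x + y"
  "\<one>\<^bsub>integers_of TYPE('k)\<^esub> = 1"
  "\<zero>\<^bsub>integers_of TYPE('k)\<^esub> = 0"
  by (simp_all add: integers_of_def ring_of_type_algebra_def)

lemma cring_integers_of: "cring (integers_of TYPE('k::field_char_0))"
proof (intro cringI abelian_groupI comm_monoidI)
  fix x :: 'k assume "x \<in> carrier (integers_of TYPE('k))"
  then show "\<exists>y\<in>carrier (integers_of TYPE('k)). y \<oplus>\<^bsub>integers_of TYPE('k)\<^esub> x = \<zero>\<^bsub>integers_of TYPE('k)\<^esub>"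
    by (intro bexI[of _ "- x"]) auto
qed (simp_all add: algebraic_int_add algebraic_int_mult add.assoc add.commute mult.assoc
    mult.commute distrib_left)

text \<open>By Zorn's lemma, \<open>S\<close> lies in an ideal that is maximal among the proper ones, hence prime.\<close>

lemma proper_ideal_in_prime_ideal:
  fixes S :: "'k::field_char_0 set"
  assumes S: "S \<subseteq> {x. algebraic_int x}" "0 \<in> S" "1 \<notin> S"
    and add: "\<And>x y. x \<in> S \<Longrightarrow> y \<in> S \<Longrightarrow> x + y \<in> S"
    and mult: "\<And>c x. algebraic_int c \<Longrightarrow> x \<in> S \<Longrightarrow> c * x \<in> S"
  obtains P where "primeideal P (integers_of TYPE('k))" "S \<subseteq> P"
proof -
  define ok where "ok = (\<lambda>A :: 'k set. A \<subseteq> {x. algebraic_int x} \<and> S \<subseteq> A \<and> 1 \<notin> A \<and>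
    (\<forall>x\<in>A. \<forall>y\<in>A. x + y \<in> A) \<and> (\<forall>c x. algebraic_int c \<longrightarrow> x \<in> A \<longrightarrow> c * x \<in> A))"
  have "\<exists>P\<in>Collect ok. \<forall>A\<in>Collect ok. P \<subseteq> A \<longrightarrow> A = P"
  proof (rule subset_Zorn_nonempty)
    have "ok S" unfolding ok_def using S add mult by simp
    then show "Collect ok \<noteq> {}" by blast
    fix C assume C: "C \<noteq> {}" "subset.chain (Collect ok) C"
    have "x + y \<in> \<Union> C" if xy: "x \<in> \<Union> C" "y \<in> \<Union> C" for x y
    proof -
      obtain A B where AB: "A \<in> C" "B \<in> C" "x \<in> A" "y \<in> B" using xy by blast
      then have "A \<subseteq> B \<or> B \<subseteq> A" using C(2) by (auto simp: subset.chain_def)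
      then obtain D where "D \<in> C" "x \<in> D" "y \<in> D" using AB by blast
      moreover from this have "ok D" using C(2) by (auto simp: subset.chain_def)
      ultimately show ?thesis unfolding ok_def by blast
    qed
    moreover have ok: "ok A" if "A \<in> C" for A using C(2) that by (auto simp: subset.chain_def)
    have "c * x \<in> \<Union> C" if c: "algebraic_int c" and "x \<in> \<Union> C" for c x
    proof -
      obtain A where "A \<in> C" "x \<in> A" using \<open>x \<in> \<Union> C\<close> by blast
      with ok[of A] c show ?thesis unfolding ok_def by blast
    qed
    moreover have "S \<subseteq> \<Union> C" using C(1) ok unfolding ok_def by blast
    moreover have "\<Union> C \<subseteq> {x. algebraic_int x}" "1 \<notin> \<Union> C"
      using ok unfolding ok_def by blast+
    ultimately show "\<Union> C \<in> Collect ok" by (simp add: ok_def)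
  qed
  then obtain P where P: "ok P" and max: "\<And>A. ok A \<Longrightarrow> P \<subseteq> A \<Longrightarrow> A = P" by blast
  have P1: "P \<subseteq> {x. algebraic_int x}" "S \<subseteq> P" "1 \<notin> P"
    and Padd: "\<And>x y. x \<in> P \<Longrightarrow> y \<in> P \<Longrightarrow> x + y \<in> P"
    and Pmult: "\<And>c x. algebraic_int c \<Longrightarrow> x \<in> P \<Longrightarrow> c * x \<in> P"
    using P unfolding ok_def by auto
  have "P \<subseteq> {x. algebraic_int x}" "0 \<in> P" using P1 S by auto
  have prime: "x \<in> P \<or> y \<in> P" if xy: "algebraic_int x" "algebraic_int y" "x * y \<in> P" for x y
  proof (rule ccontr)
    assume "\<not> ?thesis"
    then have x: "x \<notin> P" and y: "y \<notin> P" by auto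
    define A where "A = {u + c * x | u c. u \<in> P \<and> algebraic_int c}"
    have PA: "P \<subseteq> A" unfolding A_def by (force intro: exI[of _ 0])
    have "x = 0 + 1 * x" by simp
    then have xA: "x \<in> A" unfolding A_def using \<open>0 \<in> P\<close> algebraic_int_1 by blast
    then have "\<not> ok A" using max[OF _ PA] x by blast
    moreover have "A \<subseteq> {x. algebraic_int x}"
      unfolding A_def using P1(1) xy(1) by (auto intro!: algebraic_int_add algebraic_int_mult)
    moreover have "z + w \<in> A" if zw: "z \<in> A" "w \<in> A" for z w
    proof -
      obtain u c u' c' where "z = u + c * x" "w = u' + c' * x" "u \<in> P" "u' \<in> P"
        "algebraic_int c" "algebraic_int c'"
        using zw unfolding A_def by blast
      moreover from this have "z + w = (u + u') + (c + c') * x" by (simp add: algebra_simps)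
      ultimately show ?thesis unfolding A_def using Padd algebraic_int_add by blast
    qed
    moreover have "d * z \<in> A" if "algebraic_int d" "z \<in> A" for d z
    proof -
      obtain u c where "z = u + c * x" "u \<in> P" "algebraic_int c"
        using \<open>z \<in> A\<close> unfolding A_def by blast
      moreover from this have "d * z = d * u + (d * c) * x" by (simp add: algebra_simps)
      ultimately show ?thesis unfolding A_def using Pmult algebraic_int_mult that(1) by blast
    qed
    moreover have "S \<subseteq> A" using PA P1 by blast
    ultimately have "1 \<in> A" unfolding ok_def by blast
    then obtain u c where uc: "1 = u + c * x" "u \<in> P" "algebraic_int c" unfolding A_def by blast
    have "y = y * (u + c * x)" using uc(1) by simp
    also have "\<dots> = y * u + c * (x * y)" by (simp add: algebra_simps)
    finally have "y = y * u + c * (x * y)" .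
    then have "y \<in> P" using Padd Pmult uc xy by metis
    with y show False by simp
  qed
  interpret cring "integers_of TYPE('k)" by (rule cring_integers_of)
  have "ideal P (integers_of TYPE('k))"
  proof (rule idealI[OF ring_axioms])
    have neg: "- x \<in> P" if "x \<in> P" for x using Pmult[of "-1" x] that by simp
    have inv: "\<ominus>\<^bsub>integers_of TYPE('k)\<^esub> x = - x" if "x \<in> P" for x
      using that P1(1) by (intro minus_equality) auto
    show "subgroup P (add_monoid (integers_of TYPE('k)))"
    proof (rule add.subgroupI)
      show "P \<noteq> {}" using \<open>0 \<in> P\<close> by blast
    qed (use P1(1) Padd neg inv in auto)
    show "x \<otimes>\<^bsub>integers_of TYPE('k)\<^esub> u \<in> P" "u \<otimes>\<^bsub>integers_of TYPE('k)\<^esub> x \<in> P"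
      if "u \<in> P" "x \<in> carrier (integers_of TYPE('k))" for u x
      using Pmult[of x u] that by (simp_all add: mult.commute)
  qed
  then have "primeideal P (integers_of TYPE('k))"
  proof (rule primeidealI)
    show "cring (integers_of TYPE('k))" by (rule cring_integers_of)
    show "carrier (integers_of TYPE('k)) \<noteq> P" using P1(3) algebraic_int_1 by auto
  qed (use prime in auto)
  then show ?thesis using that P1(2) by blast
qed


section \<open>Integral submodules\<close>

text \<open>An associative unital algebra over a field of characteristic zero.\<close>

locale field_algebra = vector_space scale
  for scale :: "'k::field_char_0 \<Rightarrow> 'h::ring_1 \<Rightarrow> 'h" +
  assumes scale_mult_left: "scale c x * y = scale c (x * y)"
    and scale_mult_right: "x * scale c y = scale c (x * y)"
begin

text \<open>
  Submodules over the ring of algebraic integers of \<open>K\<close>. Closure under negation is not required,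
  since it follows from closure under multiplication by \<open>-1\<close>.
\<close>

definition integral_submodule :: "'h set \<Rightarrow> bool" where
  "integral_submodule M \<longleftrightarrow> 0 \<in> M \<and> (\<forall>x\<in>M. \<forall>y\<in>M. x + y \<in> M) \<and>
     (\<forall>c x. algebraic_int c \<longrightarrow> x \<in> M \<longrightarrow> scale c x \<in> M)"

lemma integral_submoduleD:
  assumes "integral_submodule M"
  shows "0 \<in> M" and "\<And>x y. x \<in> M \<Longrightarrow> y \<in> M \<Longrightarrow> x + y \<in> M"
    and "\<And>c x. algebraic_int c \<Longrightarrow> x \<in> M \<Longrightarrow> scale c x \<in> M"
    and "\<And>x y. x \<in> M \<Longrightarrow> y \<in> M \<Longrightarrow> x - y \<in> M"
proof -
  show *: "0 \<in> M" "\<And>x y. x \<in> M \<Longrightarrow> y \<in> M \<Longrightarrow> x + y \<in> M"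
    "\<And>c x. algebraic_int c \<Longrightarrow> x \<in> M \<Longrightarrow> scale c x \<in> M"
    using assms unfolding integral_submodule_def by blast+
  fix x y assume "x \<in> M" "y \<in> M"
  then show "x - y \<in> M" using *(2)[OF _ *(3)[of "- 1" y], of x] by simp
qed

text \<open>The second claim states that \<open>M\<close> is the least integral submodule that contains \<open>S\<close>.\<close>

lemma fin_gen_integral_submoduleD:
  assumes "fin_gen_integral_submodule scale M"
  shows "integral_submodule M"
    and "\<exists>S. finite S \<and> S \<subseteq> M \<and> (\<forall>N. integral_submodule N \<longrightarrow> S \<subseteq> N \<longrightarrow> M \<subseteq> N)"
proof -
  obtain S where "finite S"
    and "M = {\<Sum>s\<in>S. scale (c s) s | c. \<forall>s\<in>S. c s \<in> carrier (integers_of TYPE('k))}"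
    using assms unfolding fin_gen_integral_submodule_def by blast
  then have M: "M = {\<Sum>s\<in>S. scale (c s) s | c. \<forall>s\<in>S. algebraic_int (c s)}" by simp
  have "S \<subseteq> M"
  proof
    fix t assume "t \<in> S"
    then have "t = (\<Sum>s\<in>S. scale (if s = t then 1 else 0) s)"
      using \<open>finite S\<close> by (simp add: if_distrib[of "\<lambda>c. scale c _"] sum.delta' cong: if_cong)
    then show "t \<in> M" unfolding M by (intro CollectI exI[of _ "\<lambda>s. if s = t then 1 else 0"]) auto
  qed
  show "integral_submodule M"
    unfolding integral_submodule_def
  proof (intro conjI ballI allI impI)
    show "0 \<in> M" unfolding M by (intro CollectI exI[of _ "\<lambda>_. 0"]) simp
  next
    fix x y assume "x \<in> M" "y \<in> M"
    then obtain c d where "x = (\<Sum>s\<in>S. scale (c s) s)" "y = (\<Sum>s\<in>S. scale (d s) s)"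
      "\<forall>s\<in>S. algebraic_int (c s)" "\<forall>s\<in>S. algebraic_int (d s)" unfolding M by blast
    then show "x + y \<in> M" unfolding M
      by (intro CollectI exI[of _ "\<lambda>s. c s + d s"])
        (auto simp: scale_left_distrib sum.distrib intro: algebraic_int_add)
  next
    fix e :: 'k and x assume "algebraic_int e" "x \<in> M"
    then obtain c where "x = (\<Sum>s\<in>S. scale (c s) s)" "\<forall>s\<in>S. algebraic_int (c s)"
      unfolding M by blast
    then show "scale e x \<in> M" unfolding M using \<open>algebraic_int e\<close>
      by (intro CollectI exI[of _ "\<lambda>s. e * c s"])
        (auto simp: scale_sum_right intro: algebraic_int_mult)
  qed
  have "M \<subseteq> N" if N: "integral_submodule N" "S \<subseteq> N" for N
  proof
    fix x assume "x \<in> M"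
    then obtain c where c: "x = (\<Sum>s\<in>S. scale (c s) s)" "\<forall>s\<in>S. algebraic_int (c s)"
      unfolding M by blast
    have "(\<Sum>s\<in>T. scale (c s) s) \<in> N" if "T \<subseteq> S" for T
      using finite_subset[OF that \<open>finite S\<close>] that
      by (induction T) (use N c integral_submoduleD in auto)
    then show "x \<in> N" using c(1) by blast
  qed
  with \<open>S \<subseteq> M\<close> \<open>finite S\<close>
  show "\<exists>S. finite S \<and> S \<subseteq> M \<and> (\<forall>N. integral_submodule N \<longrightarrow> S \<subseteq> N \<longrightarrow> M \<subseteq> N)"
    by blast
qed

text \<open>
  The set \<open>T\<close> of admissible denominators will be the complement of a prime ideal or the set of
  positive integers.
\<close>

lemma common_denominator:
  assumes M: "fin_gen_integral_submodule scale M" and N: "integral_submodule N"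
    and T: "T \<subseteq> {c. algebraic_int c}" "1 \<in> T" "\<And>s t. s \<in> T \<Longrightarrow> t \<in> T \<Longrightarrow> s * t \<in> T"
    and local: "\<And>x. x \<in> M \<Longrightarrow> \<exists>s\<in>T. scale s x \<in> N"
  obtains s where "s \<in> T" "\<And>x. x \<in> M \<Longrightarrow> scale s x \<in> N"
proof -
  obtain S where S: "finite S" "S \<subseteq> M"
    and gen: "\<forall>N. integral_submodule N \<longrightarrow> S \<subseteq> N \<longrightarrow> M \<subseteq> N"
    using fin_gen_integral_submoduleD(2)[OF M] by blast
  have "\<exists>s\<in>T. \<forall>x\<in>S. scale s x \<in> N"
    using S
  proof (induction S)
    case empty
    then show ?case using T(2) by blast
  next
    case (insert x F)
    then obtain s where s: "s \<in> T" "\<forall>y\<in>F. scale s y \<in> N" by blast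
    obtain t where t: "t \<in> T" "scale t x \<in> N" using local insert.prems by blast
    have "scale (s * t) y \<in> N" if "y \<in> insert x F" for y
    proof (cases "y = x")
      case True
      then show ?thesis using s(1) t T(1) integral_submoduleD(3)[OF N, of s "scale t x"] by auto
    next
      case False
      then have "scale t (scale s y) \<in> N"
        using that s t T(1) integral_submoduleD(3)[OF N, of t "scale s y"] by auto
      then show ?thesis by (simp add: mult.commute)
    qed
    then show ?case using T(3)[OF s(1) t(1)] by blast
  qed
  then obtain s where s: "s \<in> T" "\<forall>x\<in>S. scale s x \<in> N" by blast
  have "integral_submodule {x. scale s x \<in> N}"
    unfolding integral_submodule_def
    using integral_submoduleD[OF N] by (auto simp: scale_right_distrib scale_left_commute[of s] simp del: scale_scale)
  then have "M \<subseteq> {x. scale s x \<in> N}" using gen s(2) by blast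
  then show ?thesis using that s(1) by blast
qed

lemma integer_multiple_in_lattice:
  assumes "number_field TYPE('k)" and M: "integral_submodule M" and "span M = UNIV"
  obtains n :: nat where "n > 0" "scale (of_nat n) y \<in> M"
proof -
  have "y \<in> span M" using assms(3) by simp
  then have "\<exists>n::nat. n > 0 \<and> scale (of_nat n) y \<in> M"
  proof (induction rule: span_induct_alt)
    case base
    then show ?case using integral_submoduleD(1)[OF M] by (intro exI[of _ 1]) simp
  next
    case (step c x y)
    then obtain n :: nat where n: "n > 0" "scale (of_nat n) y \<in> M" by blast
    obtain m :: nat where m: "m > 0" "algebraic_int (of_nat m * c)"
      using number_field_denominator[OF assms(1)] by blast
    have "scale (of_nat (m * n)) (scale c x + y)
        = scale (of_nat n) (scale (of_nat m * c) x) + scale (of_nat m) (scale (of_nat n) y)"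
      by (simp add: scale_right_distrib algebra_simps)
    also have "\<dots> \<in> M"
      using integral_submoduleD(2)[OF M] integral_submoduleD(3)[OF M algebraic_int_of_nat]
        integral_submoduleD(3)[OF M m(2)] n(2) step.hyps by blast
    finally show ?case using m(1) n(1) by (intro exI[of _ "m * n"]) simp
  qed
  then show ?thesis using that by blast
qed

lemma common_integer_denominator:
  assumes M: "fin_gen_integral_submodule scale M" and N: "integral_submodule N"
    and ex: "\<And>x. x \<in> M \<Longrightarrow> \<exists>n::nat. n > 0 \<and> scale (of_nat n) x \<in> N"
  obtains n :: nat where "n > 0" "\<And>x. x \<in> M \<Longrightarrow> scale (of_nat n) x \<in> N"
proof -
  define T where "T = {of_nat n :: 'k | n :: nat. n > 0}"
  have "\<exists>s\<in>T. scale s x \<in> N" if "x \<in> M" for x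
    using ex[OF that] unfolding T_def by blast
  moreover have "s * t \<in> T" if st: "s \<in> T" "t \<in> T" for s t
  proof -
    obtain m n :: nat where "s = of_nat m" "t = of_nat n" "m > 0" "n > 0"
      using st unfolding T_def by blast
    then show ?thesis unfolding T_def by (auto intro!: exI[of _ "m * n"])
  qed
  moreover have "T \<subseteq> {c. algebraic_int c}" "1 \<in> T"
    by (auto simp: T_def intro: exI[of _ 1])
  ultimately obtain s where "s \<in> T" "\<And>x. x \<in> M \<Longrightarrow> scale s x \<in> N"
    using common_denominator[OF M N, of T] by metis
  moreover from this obtain n :: nat where "s = of_nat n" "n > 0" unfolding T_def by blast
  ultimately show ?thesis using that by blast
qed

end


section \<open>Quaternion algebras with an orthogonal involution\<close>

context quaternion_algebra
begin

sublocale field_algebra scale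
  by unfold_locales (rule scale_mult_left scale_mult_right)+

text \<open>The element with coordinates \<open>w\<close>, \<open>x\<close>, \<open>y\<close>, \<open>z\<close> with respect to \<open>1\<close>, \<open>i\<close>, \<open>j\<close>, \<open>i j\<close>.\<close>

definition quaternion :: "'k \<Rightarrow> 'k \<Rightarrow> 'k \<Rightarrow> 'k \<Rightarrow> 'h" where
  "quaternion w x y z = scale w 1 + scale x i + scale y j + scale z (i * j)"

lemma quaternion_cases:
  obtains w x y z where "h = quaternion w x y z"
proof -
  have "h \<in> span {1, i, j, i * j}" using span_basis by simp
  then obtain u where "h = (\<Sum>v\<in>{1, i, j, i * j}. scale (u v) v)"
    by (subst (asm) span_finite) auto
  then have "h = quaternion (u 1) (u i) (u j) (u (i * j))"
    using distinct_basis by (simp add: quaternion_def add.assoc)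
  then show ?thesis using that by blast
qed

lemma quaternion_eq_0:
  assumes "quaternion w x y z = 0"
  shows "w = 0 \<and> x = 0 \<and> y = 0 \<and> z = 0"
proof -
  define u where "u v = (if v = 1 then w else if v = i then x else if v = j then y else z)" for v
  have u: "u 1 = w" "u i = x" "u j = y" "u (i * j) = z"
    using distinct_basis by (auto simp: u_def)
  have "(\<Sum>v\<in>{1, i, j, i * j}. scale (u v) v) = 0"
    using assms distinct_basis u by (simp add: quaternion_def add.assoc)
  then have "u v = 0" if "v \<in> {1, i, j, i * j}" for v
    using independentD[OF independent_basis, of "{1, i, j, i * j}" u v] that by auto
  then show ?thesis using u by (metis insertCI)
qed

lemma quaternion_add:
  "quaternion w x y z + quaternion w' x' y' z' = quaternion (w + w') (x + x') (y + y') (z + z')"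
  by (simp add: quaternion_def scale_left_distrib algebra_simps)

lemma quaternion_scale:
  "scale c (quaternion w x y z) = quaternion (c * w) (c * x) (c * y) (c * z)"
  by (simp add: quaternion_def scale_right_distrib)

lemma quaternion_diff:
  "quaternion w x y z - quaternion w' x' y' z' = quaternion (w - w') (x - x') (y - y') (z - z')"
  by (simp add: quaternion_def scale_left_diff_distrib algebra_simps)

lemma quaternion_inject:
  "quaternion w x y z = quaternion w' x' y' z' \<longleftrightarrow> w = w' \<and> x = x' \<and> y = y' \<and> z = z'"
  using quaternion_eq_0[of "w - w'" "x - x'" "y - y'" "z - z'"]
  by (auto simp: quaternion_diff[symmetric])

lemma scalar_eq_quaternion: "scale c 1 = quaternion c 0 0 0"
  by (simp add: quaternion_def)

lemma basis_products:
  "i * (i * j) = scale a j" "i * j * i = - scale a j"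
  "j * (i * j) = - scale b i" "i * j * j = scale b i"
  "i * j * (i * j) = - scale (a * b) 1"
proof -
  show 1: "i * (i * j) = scale a j"
    using i_square by (simp add: mult.assoc[symmetric] scale_mult_left)
  show 2: "i * j * i = - scale a j"
    using 1 by (simp add: mult.assoc anticommute)
  show 3: "i * j * j = scale b i"
    using j_square by (simp add: mult.assoc scale_mult_right)
  show "j * (i * j) = - scale b i"
    using 3 by (simp add: mult.assoc[symmetric] anticommute)
  have "i * j * (i * j) = i * j * i * j" by (simp add: mult.assoc)
  then show "i * j * (i * j) = - scale (a * b) 1"
    using j_square by (simp add: 2 scale_mult_left)
qed

lemma quaternion_mult:
  "quaternion w x y z * quaternion w' x' y' z' = quaternion
     (w * w' + a * x * x' + b * y * y' - a * b * z * z')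
     (w * x' + x * w' - b * y * z' + b * z * y')
     (w * y' + y * w' + a * x * z' - a * z * x')
     (w * z' + z * w' + x * y' - y * x')"
proof -
  define k where "k = i * j"
  have k: "i * j = k" "j * i = - k" "i * k = scale a j" "k * i = - scale a j"
    "j * k = - scale b i" "k * j = scale b i" "k * k = - scale (a * b) 1"
    using basis_products anticommute by (simp_all add: k_def)
  show ?thesis
    unfolding quaternion_def k(1)
    by (simp only: distrib_left distrib_right scale_mult_left scale_mult_right k i_square j_square
        mult_1_left mult_1_right scale_minus_right scale_scale)
      (simp add: algebra_simps)
qed

text \<open>The reduced trace and the reduced norm of \<open>h\<close> serve as \<open>T\<close> and \<open>N\<close>.\<close>

lemma quadratic_equation:
  obtains T N where "h * h = scale T h - scale N 1"
proof -
  obtain w x y z where h: "h = quaternion w x y z" by (rule quaternion_cases)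
  have "h * h = scale (2 * w) h - scale (w * w - a * x * x - b * y * y + a * b * z * z) 1"
    by (simp add: h quaternion_mult quaternion_scale scalar_eq_quaternion quaternion_diff
        quaternion_inject algebra_simps)
  then show ?thesis using that by blast
qed

lemma centralizer_of_nonscalar:
  assumes p: "p \<notin> range (\<lambda>c. scale c 1)" and comm: "p * h = h * p"
  obtains c d where "h = scale c 1 + scale d p"
proof -
  obtain w x y z where P: "p = quaternion w x y z" by (rule quaternion_cases)
  obtain w' x' y' z' where H: "h = quaternion w' x' y' z'" by (rule quaternion_cases)
  have "2 * b * (z * y' - y * z') = 0" "2 * a * (x * z' - z * x') = 0" "2 * (x * y' - y * x') = 0"
    using comm by (simp_all add: P H quaternion_mult quaternion_inject algebra_simps)
  then have e: "z * y' = y * z'" "x * z' = z * x'" "x * y' = y * x'"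
    using a_nonzero b_nonzero by simp_all
  have nz: "x \<noteq> 0 \<or> y \<noteq> 0 \<or> z \<noteq> 0"
    using p by (auto simp: P scalar_eq_quaternion quaternion_inject)
  have "\<exists>d. x' = d * x \<and> y' = d * y \<and> z' = d * z"
  proof -
    consider "x \<noteq> 0" | "y \<noteq> 0" | "z \<noteq> 0" using nz by blast
    then show ?thesis
    proof cases
      case 1
      with e show ?thesis by (intro exI[of _ "x' / x"]) (simp add: field_simps)
    next
      case 2
      with e show ?thesis by (intro exI[of _ "y' / y"]) (simp add: field_simps)
    next
      case 3
      with e show ?thesis by (intro exI[of _ "z' / z"]) (simp add: field_simps)
    qed
  qed
  then obtain d where d: "x' = d * x" "y' = d * y" "z' = d * z" by blast
  have "h = scale (w' - d * w) 1 + scale d p"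
    by (simp add: P H d scalar_eq_quaternion quaternion_scale quaternion_add)
  then show ?thesis using that by blast
qed

lemma orthogonal_involution_rules:
  assumes "orthogonal_involution scale i j \<sigma>"
  shows "\<sigma> (x + y) = \<sigma> x + \<sigma> y" "\<sigma> (x - y) = \<sigma> x - \<sigma> y" "\<sigma> (x * y) = \<sigma> y * \<sigma> x"
    "\<sigma> (\<sigma> x) = x" "\<sigma> (scale c x) = scale c (\<sigma> x)" "\<sigma> 1 = 1"
proof -
  have inv: "involution_on UNIV \<sigma>" and lin: "Vector_Spaces.linear scale scale \<sigma>"
    using assms unfolding orthogonal_involution_def by auto
  interpret L: Vector_Spaces.linear scale scale \<sigma> by (rule lin)
  show "\<sigma> (x + y) = \<sigma> x + \<sigma> y" by (rule L.add)
  show "\<sigma> (x - y) = \<sigma> x - \<sigma> y" by (rule L.diff)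
  show "\<sigma> (scale c x) = scale c (\<sigma> x)" by (rule L.scale)
  show *: "\<sigma> (x * y) = \<sigma> y * \<sigma> x" "\<sigma> (\<sigma> x) = x" for x y
    using inv unfolding involution_on_def by auto
  show "\<sigma> 1 = 1" using *(1)[of "\<sigma> 1" 1] by (simp add: *(2))
qed

text \<open>
  Suppose that only scalars are symmetric. For \<open>u \<in> {i, j, i j}\<close> the element \<open>u + \<sigma> u\<close> is then a
  scalar \<open>c\<close>, and comparing \<open>(c - u)\<^sup>2 = \<sigma> (u\<^sup>2) = u\<^sup>2\<close> gives \<open>c = 0\<close>. So \<open>\<sigma>\<close> is quaternion
  conjugation.
\<close>

lemma orthogonal_involution_nonscalar_symmetric:
  assumes "orthogonal_involution scale i j \<sigma>"
  obtains p where "\<sigma> p = p" "p \<notin> range (\<lambda>c. scale c 1)"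
proof (rule ccontr)
  note r = orthogonal_involution_rules[OF assms]
  assume "\<not> thesis"
  then have sym: "\<sigma> p = p \<Longrightarrow> \<exists>c. p = scale c 1" for p using that by blast
  have neg: "\<sigma> u = - u" if u: "u * u = scale d 1" "\<And>c. u \<noteq> scale c 1" for u d
  proof -
    obtain c where c: "u + \<sigma> u = scale c 1" using sym[of "u + \<sigma> u"] r by (auto simp: add.commute)
    then have s: "\<sigma> u = scale c 1 - u" by (simp add: algebra_simps)
    have "\<sigma> u * \<sigma> u = scale d 1"
      unfolding r(3)[of u u, symmetric] by (simp add: u(1) r(5,6))
    then have "scale (c * c) 1 - scale (2 * c) u = 0"
      unfolding s mult_2 scale_left_distrib
      by (simp add: left_diff_distrib right_diff_distrib scale_mult_left scale_mult_right
          scale_right_diff_distrib u(1) algebra_simps del: scale_left_distrib)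
    moreover have "c = 0"
    proof (rule ccontr)
      assume "c \<noteq> 0"
      have "scale (inverse (2 * c)) (scale (c * c) 1) = scale (inverse (2 * c)) (scale (2 * c) u)"
        using calculation by simp
      then have "u = scale (inverse (2 * c) * (c * c)) 1" using \<open>c \<noteq> 0\<close> by simp
      then show False using u(2) by blast
    qed
    ultimately show ?thesis using s by simp
  qed
  have ns: "i \<noteq> scale c 1" "j \<noteq> scale c 1" "i * j \<noteq> scale c 1" for c
    using quaternion_inject[of 0 1 0 0 c 0 0 0] quaternion_inject[of 0 0 1 0 c 0 0 0]
      quaternion_inject[of 0 0 0 1 c 0 0 0]
    by (simp_all add: quaternion_def)
  have \<sigma>: "\<sigma> i = - i" "\<sigma> j = - j" "\<sigma> (i * j) = - (i * j)"
    using neg[OF i_square ns(1)] neg[OF j_square ns(2)] neg[of "i * j" "- (a * b)"] ns(3)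
      basis_products by simp_all
  have "\<sigma> z = quaternion_conj scale i j z" for z
  proof -
    define c where "c = representation {1, i, j, i * j} z"
    have "z = (\<Sum>v\<in>{1, i, j, i * j}. scale (c v) v)"
      unfolding c_def using independent_basis span_basis
      by (intro sum_representation_eq[symmetric]) auto
    then have z: "z = scale (c 1) 1 + scale (c i) i + scale (c j) j + scale (c (i * j)) (i * j)"
      using distinct_basis by (simp add: add.assoc)
    have "\<sigma> z = scale (c 1) 1 - scale (c i) i - scale (c j) j - scale (c (i * j)) (i * j)"
      by (subst z) (simp only: r(1,5,6) \<sigma> scale_minus_right diff_conv_add_uminus)
    then show ?thesis by (simp add: quaternion_conj_def c_def Let_def)
  qed
  then show False using assms unfolding orthogonal_involution_def by blast
qed

text \<open>
  Since \<open>x\<close> and \<open>\<sigma> x\<close> are roots of the same \<open>X\<^sup>2 - T X + N\<close>, the element \<open>t = \<sigma> x y - y (T - x)\<close>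
  satisfies \<open>t x = \<sigma> x t\<close>, and \<open>t\<close> is symmetric if \<open>y\<close> is. If \<open>t\<close> vanishes for \<open>y = 1\<close> and for a
  nonscalar symmetric \<open>y = p\<close>, then \<open>x\<close> commutes with \<open>p\<close>, so that \<open>x \<in> K + K p\<close> is itself
  symmetric.
\<close>

lemma symmetric_multiplier:
  assumes "orthogonal_involution scale i j \<sigma>"
  obtains t where "t \<noteq> 0" "\<sigma> t = t" "\<sigma> (t * x) = t * x"
proof -
  note r = orthogonal_involution_rules[OF assms]
  obtain p where p: "\<sigma> p = p" "p \<notin> range (\<lambda>c. scale c 1)"
    using orthogonal_involution_nonscalar_symmetric[OF assms] by blast
  obtain T N where q: "x * x = scale T x - scale N 1" by (rule quadratic_equation)
  have q': "\<sigma> x * \<sigma> x = scale T (\<sigma> x) - scale N 1"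
    using arg_cong[OF q, of \<sigma>] by (simp add: r)
  define t where "t y = \<sigma> x * y - y * (scale T 1 - x)" for y
  have t: "\<sigma> (t y) = t y" "\<sigma> (t y * x) = t y * x" if y: "\<sigma> y = y" for y
  proof -
    show s: "\<sigma> (t y) = t y"
      by (simp add: t_def r y algebra_simps scale_mult_left scale_mult_right)
    have "t y * x = \<sigma> x * y * x + y * (x * x) - scale T (y * x)"
      by (simp add: t_def algebra_simps scale_mult_left scale_mult_right)
    also have "\<dots> = \<sigma> x * y * x - scale N y"
      by (simp add: q algebra_simps scale_mult_right)
    also have "\<dots> = \<sigma> x * \<sigma> x * y - scale T (\<sigma> x * y) + \<sigma> x * y * x"
      by (simp add: q' algebra_simps scale_mult_left)
    also have "\<dots> = \<sigma> x * t y"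
      by (simp add: t_def algebra_simps scale_mult_left scale_mult_right)
    finally have "t y * x = \<sigma> x * t y" .
    then show "\<sigma> (t y * x) = t y * x" by (simp add: r s)
  qed
  show ?thesis
  proof (cases "t 1 = 0 \<and> t p = 0")
    case True
    then have 1: "\<sigma> x = scale T 1 - x" by (simp add: t_def algebra_simps)
    with True have "p * x = x * p"
      by (simp add: t_def algebra_simps scale_mult_left scale_mult_right)
    then obtain c d where "x = scale c 1 + scale d p"
      using centralizer_of_nonscalar[OF p(2)] by blast
    then have "\<sigma> x = x" by (simp add: r p)
    then show ?thesis using that[of 1] by (simp add: r)
  next
    case False
    then show ?thesis using that t p(1) r(6) by metis
  qed
qed

end


section \<open>Generators modulo an integer\<close>

lemma binomial_power_split:
  fixes s t :: "'k::field_char_0"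
  assumes "algebraic_int s" "algebraic_int t"
  shows "\<exists>c d. algebraic_int c \<and> algebraic_int d \<and> (s + t) ^ (p + q) = s ^ p * c + t ^ q * d"
proof (induction "p + q" arbitrary: p q)
  case 0
  then show ?case by (intro exI[of _ 0] exI[of _ 1]) simp
next
  case (Suc n)
  show ?case
  proof (cases "p = 0 \<or> q = 0")
    case True
    moreover have "algebraic_int ((s + t) ^ (p + q))"
      using assms by (intro algebraic_int_power algebraic_int_add)
    ultimately show ?thesis
      by (metis add.left_neutral add.right_neutral algebraic_int_0 mult.left_neutral
          mult_zero_right power_0)
  next
    case False
    then obtain p' q' where pq: "p = Suc p'" "q = Suc q'" by (metis not0_implies_Suc)
    have n: "n = p' + q" "n = p + q'" using Suc.hyps(2) pq by simp_all
    obtain c d where cd: "algebraic_int c" "algebraic_int d"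
      "(s + t) ^ (p' + q) = s ^ p' * c + t ^ q * d"
      using Suc.hyps(1)[OF n(1)] by blast
    obtain c' d' where cd': "algebraic_int c'" "algebraic_int d'"
      "(s + t) ^ (p + q') = s ^ p * c' + t ^ q' * d'"
      using Suc.hyps(1)[OF n(2)] by blast
    have "(s + t) ^ (p + q) = s * (s + t) ^ (p' + q) + t * (s + t) ^ (p + q')"
      using pq by (simp add: distrib_right)
    also have "\<dots> = s ^ p * (c + t * c') + t ^ q * (s * d + d')"
      unfolding cd(3) cd'(3) using pq by (simp add: algebra_simps)
    finally show ?thesis
      using cd cd' assms algebraic_int_add algebraic_int_mult by metis
  qed
qed

context field_algebra
begin

text \<open>The set \<open>x \<O> + m I\<close>.\<close>

definition principal_plus :: "'h set \<Rightarrow> nat \<Rightarrow> 'h set \<Rightarrow> 'h \<Rightarrow> 'h set" where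
  "principal_plus \<O> m I x = {x * u + scale (of_nat m) z | u z. u \<in> \<O> \<and> z \<in> I}"

lemma principal_plusI:
  "u \<in> \<O> \<Longrightarrow> z \<in> I \<Longrightarrow> y = x * u + scale (of_nat m) z \<Longrightarrow> y \<in> principal_plus \<O> m I x"
  unfolding principal_plus_def by blast

lemma integral_submodule_principal_plus:
  assumes "integral_submodule \<O>" "integral_submodule I"
  shows "integral_submodule (principal_plus \<O> m I x)"
  unfolding integral_submodule_def
proof (intro conjI ballI allI impI)
  show "0 \<in> principal_plus \<O> m I x"
    using assms by (intro principal_plusI[of 0 _ 0]) (simp_all add: integral_submoduleD)
next
  fix y y' assume "y \<in> principal_plus \<O> m I x" "y' \<in> principal_plus \<O> m I x"
  then obtain u z u' z' where "u \<in> \<O>" "z \<in> I" "y = x * u + scale (of_nat m) z"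
    "u' \<in> \<O>" "z' \<in> I" "y' = x * u' + scale (of_nat m) z'" unfolding principal_plus_def by blast
  then show "y + y' \<in> principal_plus \<O> m I x"
    using assms by (intro principal_plusI[of "u + u'" _ "z + z'"])
      (simp_all add: integral_submoduleD distrib_left scale_right_distrib)
next
  fix c :: 'k and y assume c: "algebraic_int c" and "y \<in> principal_plus \<O> m I x"
  then obtain u z where "u \<in> \<O>" "z \<in> I" "y = x * u + scale (of_nat m) z"
    unfolding principal_plus_def by blast
  then show "scale c y \<in> principal_plus \<O> m I x"
    using assms c by (intro principal_plusI[of "scale c u" _ "scale c z"])
      (simp_all add: integral_submoduleD scale_mult_right scale_right_distrib mult.commute)
qed

text \<open>
  If \<open>s I \<subseteq> x \<O> + m I\<close> and \<open>s' I \<subseteq> x' \<O> + m I\<close>, then with a power \<open>e\<close> of \<open>s\<close> that is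
  idempotent modulo \<open>m\<close>, the single element \<open>e x + (1 - e) x'\<close> serves for both \<open>e\<close> and \<open>s'\<close>.
\<close>

lemma glue_generators:
  assumes \<O>: "integral_submodule \<O>" and I: "integral_submodule I"
    and IO: "\<And>y u. y \<in> I \<Longrightarrow> u \<in> \<O> \<Longrightarrow> y * u \<in> I"
    and m: "m > 0" and s: "algebraic_int s" and x: "x \<in> I" "x' \<in> I"
    and sx: "\<And>y. y \<in> I \<Longrightarrow> scale s y \<in> principal_plus \<O> m I x"
    and sx': "\<And>y. y \<in> I \<Longrightarrow> scale s' y \<in> principal_plus \<O> m I x'"
  obtains e k where "algebraic_int e" "scale e x + scale (1 - e) x' \<in> I"
    "\<And>y. y \<in> I \<Longrightarrow> scale (s ^ k) y \<in> principal_plus \<O> m I (scale e x + scale (1 - e) x')"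
    "\<And>y. y \<in> I \<Longrightarrow> scale s' y \<in> principal_plus \<O> m I (scale e x + scale (1 - e) x')"
proof -
  obtain k r where k: "k > 0" and r: "algebraic_int r" and "s ^ k * s ^ k - s ^ k = of_nat m * r"
    using algebraic_int_idempotent_power[OF s m] by blast
  moreover define e where "e = s ^ k"
  ultimately have ee: "e * e = e + of_nat m * r" by (simp add: algebra_simps)
  have e: "algebraic_int e" using s by (simp add: e_def algebraic_int_power)
  define g where "g = scale e x + scale (1 - e) x'"
  define w where "w = scale r x - scale r x'"
  have e1: "algebraic_int (1 - e)" using e by (simp add: algebraic_int_diff)
  have gI: "g \<in> I" and wI: "w \<in> I"
    unfolding g_def w_def using x e e1 r by (simp_all add: integral_submoduleD[OF I])
  have eg: "scale e g = scale e x + scale (of_nat m) w"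
  proof -
    have "scale e g = scale (e * e) x + scale (e - e * e) x'"
      by (simp add: g_def scale_right_distrib right_diff_distrib)
    then show ?thesis
      by (simp add: ee w_def scale_left_distrib scale_right_diff_distrib)
  qed
  have e1g: "scale (1 - e) g = scale (1 - e) x' - scale (of_nat m) w"
    using eg by (simp add: scale_left_diff_distrib g_def)
  have A: "scale e y \<in> principal_plus \<O> m I g" if y: "y \<in> I" for y
  proof -
    obtain u z where uz: "u \<in> \<O>" "z \<in> I" "scale s y = x * u + scale (of_nat m) z"
      using sx[OF y] unfolding principal_plus_def by blast
    define c where "c = s ^ (k - 1)"
    have c: "algebraic_int c" "e = c * s"
      using s power_minus_mult[OF k, of s] by (simp_all add: c_def e_def algebraic_int_power)
    define u' where "u' = scale c u"
    have u': "u' \<in> \<O>" using uz c by (simp add: u'_def integral_submoduleD[OF \<O>])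
    have "scale (e * e) y = scale (e * c) (scale s y)"
      by (simp add: c(2) mult_ac)
    also have "\<dots> = scale e x * u' + scale (of_nat m) (scale (e * c) z)"
      by (simp add: uz(3) u'_def scale_right_distrib scale_mult_left scale_mult_right mult_ac)
    also have "scale e x = scale e g - scale (of_nat m) w" using eg by simp
    finally have "scale (e * e) y
        = g * scale e u' + scale (of_nat m) (scale (e * c) z - w * u')"
      by (simp add: left_diff_distrib scale_mult_left scale_mult_right scale_right_diff_distrib)
    then have "scale e y
        = g * scale e u' + scale (of_nat m) (scale (e * c) z - w * u' - scale r y)"
      by (simp add: ee scale_left_distrib scale_right_diff_distrib algebra_simps)
    moreover have "scale (e * c) z - w * u' - scale r y \<in> I"
      using uz(2) wI u' y e c(1) r
      by (simp add: integral_submoduleD[OF I] IO algebraic_int_mult)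
    moreover have "scale e u' \<in> \<O>" using e u' by (simp add: integral_submoduleD[OF \<O>])
    ultimately show ?thesis by (intro principal_plusI)
  qed
  note P = integral_submoduleD[OF integral_submodule_principal_plus[OF \<O> I]]
  have B: "scale s' y \<in> principal_plus \<O> m I g" if y: "y \<in> I" for y
  proof -
    obtain u z where uz: "u \<in> \<O>" "z \<in> I" "scale s' y = x' * u + scale (of_nat m) z"
      using sx'[OF y] unfolding principal_plus_def by blast
    have "scale (1 - e) x' * u = g * scale (1 - e) u + scale (of_nat m) (w * u)"
      using arg_cong[OF e1g, of "\<lambda>h. h * u"]
      by (simp add: left_diff_distrib scale_mult_left scale_mult_right)
    moreover have "scale s' y = scale e (x' * u) + scale (1 - e) x' * u + scale (of_nat m) z"
      by (simp add: uz(3) scale_mult_left scale_left_diff_distrib left_diff_distrib)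
    ultimately have "scale s' y = scale e (x' * u)
        + (g * scale (1 - e) u + scale (of_nat m) (w * u + z))"
      by (simp only: scale_right_distrib add.assoc)
    moreover have "scale e (x' * u) \<in> principal_plus \<O> m I g" using A IO x(2) uz(1) by blast
    moreover have "g * scale (1 - e) u + scale (of_nat m) (w * u + z) \<in> principal_plus \<O> m I g"
      using uz wI IO e1 by (intro principal_plusI[OF _ _ refl])
        (simp_all add: integral_submoduleD[OF \<O>] integral_submoduleD[OF I])
    ultimately show ?thesis using P(2) by simp
  qed
  show ?thesis
    using that[OF e, of k] gI A B unfolding g_def e_def by blast
qed

text \<open>
  The elements \<open>s\<close> for which some power of \<open>s\<close> multiplies \<open>I\<close> into \<open>x \<O> + m I\<close>, for some \<open>x \<in> I\<close>
  that may depend on \<open>s\<close>, form an ideal by the preceding lemma. Since \<open>I\<close> is locally principal, no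
  prime ideal contains it, so that it contains \<open>1\<close>.
\<close>

lemma generator_modulo_integer:
  assumes \<O>: "integral_submodule \<O>" and I: "integral_submodule I"
    and IO: "\<And>y u. y \<in> I \<Longrightarrow> u \<in> \<O> \<Longrightarrow> y * u \<in> I" and m: "m > 0"
    and loc: "\<And>P. primeideal P (integers_of TYPE('k)) \<Longrightarrow> P \<noteq> {0} \<Longrightarrow>
       \<exists>s x. algebraic_int s \<and> s \<notin> P \<and> x \<in> I \<and> (\<forall>y\<in>I. scale s y \<in> (*) x ` \<O>)"
  obtains x where "x \<in> I" "I \<subseteq> principal_plus \<O> m I x"
proof -
  define S where "S = {s. algebraic_int s \<and>
    (\<exists>x\<in>I. \<exists>k. \<forall>y\<in>I. scale (s ^ k) y \<in> principal_plus \<O> m I x)}"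
  note P = integral_submoduleD[OF integral_submodule_principal_plus[OF \<O> I]]
  have SI: "s \<in> S" if "algebraic_int s" "x \<in> I" "\<And>y. y \<in> I \<Longrightarrow> scale (s ^ k) y \<in> principal_plus \<O> m I x"
    for s x k
    using that unfolding S_def by blast
  have mS: "of_nat m \<in> S"
    by (rule SI[of _ 0 1]) (auto intro!: principal_plusI[of 0] integral_submoduleD(1) \<O> I)
  have mult: "c * s \<in> S" if c: "algebraic_int c" and "s \<in> S" for c s
  proof -
    obtain x k where *: "algebraic_int s" "x \<in> I" "\<forall>y\<in>I. scale (s ^ k) y \<in> principal_plus \<O> m I x"
      using \<open>s \<in> S\<close> unfolding S_def by blast
    show ?thesis
    proof (rule SI)
      fix y assume "y \<in> I"
      then have "scale (c ^ k) (scale (s ^ k) y) \<in> principal_plus \<O> m I x"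
        using * P(3)[OF algebraic_int_power[OF c]] by blast
      then show "scale ((c * s) ^ k) y \<in> principal_plus \<O> m I x" by (simp add: power_mult_distrib)
    qed (use * c in \<open>auto intro: algebraic_int_mult\<close>)
  qed
  have add: "s + t \<in> S" if st: "s \<in> S" "t \<in> S" for s t
  proof -
    obtain x k where s: "algebraic_int s" "x \<in> I"
      "\<And>y. y \<in> I \<Longrightarrow> scale (s ^ k) y \<in> principal_plus \<O> m I x"
      using st(1) unfolding S_def by blast
    obtain x' l where t: "algebraic_int t" "x' \<in> I"
      "\<And>y. y \<in> I \<Longrightarrow> scale (t ^ l) y \<in> principal_plus \<O> m I x'"
      using st(2) unfolding S_def by blast
    obtain g n where g: "g \<in> I" "\<And>y. y \<in> I \<Longrightarrow> scale ((s ^ k) ^ n) y \<in> principal_plus \<O> m I g"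
      "\<And>y. y \<in> I \<Longrightarrow> scale (t ^ l) y \<in> principal_plus \<O> m I g"
      using glue_generators[OF \<O> I IO m algebraic_int_power[OF s(1)] s(2) t(2) s(3) t(3)] by metis
    obtain c d where cd: "algebraic_int c" "algebraic_int d"
      "(s + t) ^ (k * n + l) = s ^ (k * n) * c + t ^ l * d"
      using binomial_power_split[OF s(1) t(1)] by blast
    show ?thesis
    proof (rule SI[OF algebraic_int_add[OF s(1) t(1)] g(1)])
      fix y assume "y \<in> I"
      then have "scale c (scale ((s ^ k) ^ n) y) + scale d (scale (t ^ l) y) \<in> principal_plus \<O> m I g"
        by (intro P(2) P(3)[OF cd(1)] P(3)[OF cd(2)] g(2,3))
      then show "scale ((s + t) ^ (k * n + l)) y \<in> principal_plus \<O> m I g"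
        unfolding cd(3) by (simp add: scale_left_distrib power_mult mult.commute)
    qed
  qed
  have "1 \<in> S"
  proof (rule ccontr)
    assume "1 \<notin> S"
    moreover have "0 \<in> S" using mult[OF algebraic_int_0 mS] by simp
    moreover have "S \<subseteq> {x. algebraic_int x}" unfolding S_def by blast
    ultimately obtain Q where Q: "primeideal Q (integers_of TYPE('k))" "S \<subseteq> Q"
      using proper_ideal_in_prime_ideal[OF _ _ _ add mult] by metis
    have "Q \<noteq> {0}" using Q(2) mS m by auto
    then obtain s x where s: "algebraic_int s" "s \<notin> Q" "x \<in> I" "\<forall>y\<in>I. scale s y \<in> (*) x ` \<O>"
      using loc[OF Q(1)] by blast
    have "s \<in> S"
    proof (rule SI[OF s(1,3)])
      fix y assume "y \<in> I"
      then obtain u where "u \<in> \<O>" "scale s y = x * u" using s(4) by blast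
      then show "scale (s ^ 1) y \<in> principal_plus \<O> m I x"
        using integral_submoduleD(1)[OF I] by (intro principal_plusI[of u _ 0]) auto
    qed
    then show False using Q(2) s(2) by blast
  qed
  then show ?thesis using that unfolding S_def by (auto simp: subset_iff)
qed

end


section \<open>Orders without zero divisors\<close>

text \<open>An order without zero divisors in a quaternion algebra over a number field.\<close>

locale quaternion_domain = quaternion_algebra scale a b i j
  for scale :: "'k::field_char_0 \<Rightarrow> 'h::ring_1 \<Rightarrow> 'h" and a b i j +
  fixes \<O> :: "'h set"
  assumes number_field: "number_field TYPE('k)"
    and order: "quaternion_order scale \<O>"
    and domain: "\<And>x y. x \<in> \<O> \<Longrightarrow> y \<in> \<O> \<Longrightarrow> x * y = 0 \<Longrightarrow> x = 0 \<or> y = 0"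
begin

lemma order_fin_gen: "fin_gen_integral_submodule scale \<O>"
  and order_span: "span \<O> = UNIV"
  using order unfolding quaternion_order_def by auto

lemma order_submodule: "integral_submodule \<O>"
  using fin_gen_integral_submoduleD(1)[OF order_fin_gen] .

lemma order_one: "1 \<in> \<O>"
  and order_mult: "x \<in> \<O> \<Longrightarrow> y \<in> \<O> \<Longrightarrow> x * y \<in> \<O>"
proof -
  have "subring \<O> ring_of_type_algebra" using order unfolding quaternion_order_def by blast
  then have "submonoid \<O> (ring_of_type_algebra :: 'h ring)" by (rule subring.axioms(2))
  then show "1 \<in> \<O>" "x \<in> \<O> \<Longrightarrow> y \<in> \<O> \<Longrightarrow> x * y \<in> \<O>"
    using submonoid.one_closed[of \<O> "ring_of_type_algebra :: 'h ring"]
      submonoid.m_closed[of \<O> "ring_of_type_algebra :: 'h ring" x y]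
    by (simp_all add: ring_of_type_algebra_def)
qed

lemma no_zero_divisors:
  fixes x y :: 'h
  assumes "x * y = 0"
  shows "x = 0 \<or> y = 0"
proof -
  obtain m :: nat where m: "m > 0" "scale (of_nat m) x \<in> \<O>"
    by (rule integer_multiple_in_lattice[OF number_field order_submodule order_span])
  obtain n :: nat where n: "n > 0" "scale (of_nat n) y \<in> \<O>"
    by (rule integer_multiple_in_lattice[OF number_field order_submodule order_span])
  have "scale (of_nat m) x * scale (of_nat n) y = 0"
    using assms by (simp add: scale_mult_left scale_mult_right)
  then show ?thesis using domain[OF m(2) n(2)] m(1) n(1) by auto
qed

text \<open>
  If \<open>x\<^sup>2 = T x - N\<close> and \<open>N\<close> is nonzero, the inverse of \<open>x\<close> is \<open>(T - x) / N\<close>. If \<open>N = 0\<close>, then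
  \<open>x (x - T) = 0\<close>, and \<open>x\<close> is a scalar.
\<close>

lemma inverse_exists:
  fixes x :: 'h
  assumes "x \<noteq> 0"
  obtains y where "x * y = 1" "y * x = 1"
proof -
  obtain T N where TN: "x * x = scale T x - scale N 1" by (rule quadratic_equation)
  show ?thesis
  proof (cases "N = 0")
    case False
    have "x * (scale T 1 - x) = scale N 1" "(scale T 1 - x) * x = scale N 1"
      by (simp_all add: left_diff_distrib right_diff_distrib TN scale_mult_left scale_mult_right)
    then show ?thesis
      using False that[of "scale (inverse N) (scale T 1 - x)"]
      by (simp add: scale_mult_left scale_mult_right)
  next
    case True
    then have "x * (x - scale T 1) = 0"
      by (simp add: right_diff_distrib TN scale_mult_right)
    then have x: "x = scale T 1" using no_zero_divisors assms by fastforce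
    then have "T \<noteq> 0" using assms by auto
    then show ?thesis
      using that[of "scale (inverse T) 1"] by (simp add: x scale_mult_left scale_mult_right)
  qed
qed

lemma nonzero_is_unit: "x \<noteq> 0 \<Longrightarrow> x \<in> Units (ring_of_type_algebra :: 'h ring)"
  using inverse_exists[of x] by (auto simp: Units_def ring_of_type_algebra_def)

text \<open>
  A generator of the localization of \<open>I\<close> at \<open>P\<close> can be taken in \<open>I\<close>, and finitely many generators of
  \<open>I\<close> have a common denominator outside \<open>P\<close>.
\<close>

lemma locally_principal_generator:
  assumes I: "right_fractional_ideal scale \<O> I" "locally_principal scale \<O> I"
    and P: "primeideal P (integers_of TYPE('k))" "P \<noteq> {0}"
  shows "\<exists>s x. algebraic_int s \<and> s \<notin> P \<and> x \<in> I \<and> (\<forall>y\<in>I. scale s y \<in> (*) x ` \<O>)"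
proof -
  have "ideal P (integers_of TYPE('k))" using P(1) by (rule primeideal.axioms(1))
  then have "0 \<in> P"
    using additive_subgroup.zero_closed[OF ideal.axioms(1)] by fastforce
  moreover have P_mult: "c * x \<in> P" if "algebraic_int c" "x \<in> P" for c x
    using ideal.I_l_closed[OF \<open>ideal P (integers_of TYPE('k))\<close>, of x c] that by simp
  moreover have "P \<subseteq> {x. algebraic_int x}" "P \<noteq> {x. algebraic_int x}"
    using additive_subgroup.a_subset[OF ideal.axioms(1)[OF \<open>ideal P (integers_of TYPE('k))\<close>]]
      primeideal.I_notcarr[OF P(1)] by auto
  ultimately have "1 \<notin> P" using P_mult[of _ 1] by auto
  obtain x where x: "localize scale P I = (*) x ` localize scale P \<O>"
    using I(2) P unfolding locally_principal_def by blast
  define T where "T = {s :: 'k. algebraic_int s} - P"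
  have T1: "1 \<in> T" using \<open>1 \<notin> P\<close> unfolding T_def by simp
  have Tmult: "s * t \<in> T" if "s \<in> T" "t \<in> T" for s t
    using that primeideal.I_prime[OF P(1), of s t] unfolding T_def by (auto intro: algebraic_int_mult)
  have loc: "y \<in> localize scale P M \<longleftrightarrow> (\<exists>s\<in>T. \<exists>z\<in>M. y = scale (inverse s) z)" for y M
    unfolding localize_def T_def by auto
  have mem: "y \<in> localize scale P M" if "y \<in> M" for y M
    unfolding loc using T1 that by (intro bexI[of _ 1] bexI[of _ y]) auto
  have "x \<in> localize scale P I"
    unfolding x using mem[OF order_one] by (intro image_eqI[of _ _ 1]) auto
  then obtain r x' where r: "r \<in> T" "x' \<in> I" "x = scale (inverse r) x'" unfolding loc by blast
  have nz: "s \<noteq> 0" if "s \<in> T" for s using that \<open>0 \<in> P\<close> by (auto simp: T_def)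
  have "integral_submodule ((*) x' ` \<O>)"
    using integral_submoduleD[OF order_submodule]
    unfolding integral_submodule_def
    by (auto simp: image_iff scale_mult_right[symmetric] distrib_left[symmetric] intro: bexI[of _ 0])
  moreover have "fin_gen_integral_submodule scale I"
    using I(1) unfolding right_fractional_ideal_def by blast
  moreover have "\<exists>s\<in>T. scale s y \<in> (*) x' ` \<O>" if "y \<in> I" for y
  proof -
    have "y \<in> (*) x ` localize scale P \<O>" using mem[OF that] x by simp
    then obtain w where "w \<in> localize scale P \<O>" "y = x * w" by blast
    then obtain s u where su: "s \<in> T" "u \<in> \<O>" "y = x * scale (inverse s) u"
      using loc[of w \<O>] by blast
    have "scale (r * s) y = x' * u"
      using nz[OF r(1)] nz[OF su(1)]
      by (simp add: su(3) r(3) scale_mult_left scale_mult_right divide_simps)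
    then show ?thesis using Tmult[OF r(1) su(1)] su(2) by blast
  qed
  ultimately obtain s where "s \<in> T" "\<And>y. y \<in> I \<Longrightarrow> scale s y \<in> (*) x' ` \<O>"
    using common_denominator[OF _ _ _ T1 Tmult] unfolding T_def by (metis (no_types) Diff_subset)
  then show ?thesis using r(2) unfolding T_def by blast
qed

text \<open>
  Up to left multiplication, \<open>I\<close> is generated by a symmetric element and an integer. In the proof,
  \<open>I = x \<O> + m I\<close> for a suitable integer \<open>m\<close>, and \<open>I\<close> contains the integer \<open>E\<close>. At the primes that
  do not divide \<open>m\<close> the ideal \<open>t I\<close> is generated by \<open>t E\<close>, at the others by \<open>t x\<close>. For symmetric \<open>t\<close>
  with symmetric \<open>t x\<close>, gluing these two elements gives a symmetric generator of \<open>t I\<close> modulo any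
  prescribed integer, in particular modulo an integer in \<open>t I\<close>.
\<close>

lemma symmetric_two_generators:
  assumes \<sigma>: "orthogonal_involution scale i j \<sigma>"
    and I: "right_fractional_ideal scale \<O> I" "locally_principal scale \<O> I"
  obtains t s and n :: nat where "t \<noteq> 0" "s \<in> \<O>" "\<sigma> s = s" "n > 0"
    "(*) t ` I = {s * u + scale (of_nat n) 1 * v | u v. u \<in> \<O> \<and> v \<in> \<O>}"
proof -
  note r = orthogonal_involution_rules[OF \<sigma>]
  have fg: "fin_gen_integral_submodule scale I" and span: "span I = UNIV"
    and IO: "\<And>x u. x \<in> I \<Longrightarrow> u \<in> \<O> \<Longrightarrow> x * u \<in> I"
    using I(1) unfolding right_fractional_ideal_def by auto
  note I' = fin_gen_integral_submoduleD(1)[OF fg]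
  note ID = integral_submoduleD[OF I'] and OD = integral_submoduleD[OF order_submodule]
  obtain D :: nat where D: "D > 0" "\<And>x. x \<in> I \<Longrightarrow> scale (of_nat D) x \<in> \<O>"
    using common_integer_denominator[OF fg order_submodule]
      integer_multiple_in_lattice[OF number_field order_submodule order_span] by metis
  obtain E :: nat where E: "E > 0" "scale (of_nat E) 1 \<in> I"
    by (rule integer_multiple_in_lattice[OF number_field I' span])
  \<comment> \<open>With this choice, \<open>m I \<subseteq> E \<O> \<subseteq> I\<close>.\<close>
  define m where "m = D * E"
  have m: "m > 0" using D E by (simp add: m_def)
  obtain x where x: "x \<in> I" "I \<subseteq> principal_plus \<O> m I x" "x \<noteq> 0"
  proof -
    obtain x where x: "x \<in> I" "I \<subseteq> principal_plus \<O> m I x"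
      using generator_modulo_integer[OF order_submodule I' IO m locally_principal_generator[OF I]]
      by blast
    show thesis
    proof (cases "x = 0")
      case True
      \<comment> \<open>Here \<open>I = m I\<close>, and any nonzero element of \<open>I\<close> can replace \<open>x\<close>.\<close>
      have "I \<subseteq> principal_plus \<O> m I (scale (of_nat E) 1)"
      proof
        fix y assume "y \<in> I"
        then obtain z where "z \<in> I" "y = scale (of_nat m) z"
          using x(2) True unfolding principal_plus_def by auto
        then show "y \<in> principal_plus \<O> m I (scale (of_nat E) 1)"
          using OD(1) by (intro principal_plusI[of 0]) auto
      qed
      then show ?thesis using that[of "scale (of_nat E) 1"] E by simp
    qed (use that x in blast)
  qed
  obtain xi where xi: "x * xi = 1" using inverse_exists[OF x(3)] by blast
  \<comment> \<open>The set \<open>principal_plus \<O> 0 I x\<close> is just \<open>x \<O>\<close>.\<close>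
  have xO: "integral_submodule (principal_plus \<O> 0 I x)"
    by (rule integral_submodule_principal_plus[OF order_submodule I'])
  have xOI: "x * u \<in> principal_plus \<O> 0 I x" if "u \<in> \<O>" for u
    using that ID(1) by (intro principal_plusI[of u _ 0]) auto
  have "\<exists>n::nat. n > 0 \<and> scale (of_nat n) y \<in> principal_plus \<O> 0 I x" for y
  proof -
    obtain n :: nat where n: "n > 0" "scale (of_nat n) (xi * y) \<in> \<O>"
      by (rule integer_multiple_in_lattice[OF number_field order_submodule order_span])
    have "scale (of_nat n) y = x * scale (of_nat n) (xi * y)"
      using xi by (simp add: scale_mult_right mult.assoc[symmetric])
    then show ?thesis using xOI[OF n(2)] n(1) by metis
  qed
  then obtain M :: nat where M: "M > 0"
    "\<And>y. y \<in> I \<Longrightarrow> scale (of_nat M) y \<in> principal_plus \<O> 0 I x"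
    using common_integer_denominator[OF fg xO] by metis
  obtain k rr where k: "k > 0" and rr: "algebraic_int rr"
    and krr: "(of_nat m :: 'k) ^ k * of_nat m ^ k - of_nat m ^ k = of_nat M * rr"
    using algebraic_int_idempotent_power[OF algebraic_int_of_nat M(1)] by metis
  have pow: "\<exists>u\<in>\<O>. \<exists>z\<in>I. y = x * u + scale (of_nat m ^ n) z" if "y \<in> I" for y n
  proof (induction n)
    case 0
    show ?case using that OD(1) by (intro bexI[of _ 0] bexI[of _ y]) auto
  next
    case (Suc n)
    then obtain u z where uz: "u \<in> \<O>" "z \<in> I" "y = x * u + scale (of_nat m ^ n) z" by blast
    obtain u' z' where uz': "u' \<in> \<O>" "z' \<in> I" "z = x * u' + scale (of_nat m) z'"
      using x(2) uz(2) unfolding principal_plus_def by blast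
    have "y = x * (u + scale (of_nat m ^ n) u') + scale (of_nat m ^ Suc n) z'"
      by (simp add: uz(3) uz'(3) distrib_left scale_right_distrib scale_mult_right mult.commute)
    moreover have "u + scale (of_nat m ^ n) u' \<in> \<O>"
      by (intro OD(2,3) uz(1) uz'(1) algebraic_int_power algebraic_int_of_nat)
    ultimately show ?case using uz'(2) by blast
  qed
  \<comment> \<open>\<open>I = x \<O> + m\<^sup>k I\<close>, and \<open>1 - m\<^sup>k\<close> maps \<open>m\<^sup>k I\<close> into \<open>M I \<subseteq> x \<O>\<close> by the choice of \<open>k\<close>.\<close>
  have kx: "scale (1 - of_nat m ^ k) y \<in> principal_plus \<O> 0 I x" if y: "y \<in> I" for y
  proof -
    obtain u z where uz: "u \<in> \<O>" "z \<in> I" "y = x * u + scale (of_nat m ^ k) z"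
      using pow[OF y] by blast
    have a1: "algebraic_int (1 - of_nat m ^ k :: 'k)"
      by (intro algebraic_int_diff algebraic_int_power) auto
    have "(1 - of_nat m ^ k) * of_nat m ^ k = - (rr * of_nat M :: 'k)"
      using krr by (simp add: algebra_simps)
    then have "scale (1 - of_nat m ^ k) y
        = x * scale (1 - of_nat m ^ k) u - scale rr (scale (of_nat M) z)"
      by (simp add: uz(3) scale_right_distrib scale_mult_right)
    also have "\<dots> \<in> principal_plus \<O> 0 I x"
      by (intro integral_submoduleD(4)[OF xO] integral_submoduleD(3)[OF xO rr] xOI M(2) OD(3) uz a1)
    finally show ?thesis .
  qed
  obtain t0 where t0: "t0 \<noteq> 0" "\<sigma> t0 = t0" "\<sigma> (t0 * x) = t0 * x"
    using symmetric_multiplier[OF \<sigma>] by blast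
  have "integral_submodule {y. t0 * y \<in> \<O>}"
    unfolding integral_submodule_def using OD by (auto simp: distrib_left scale_mult_right)
  moreover have "\<exists>n::nat. n > 0 \<and> scale (of_nat n) y \<in> {y. t0 * y \<in> \<O>}" for y
    using integer_multiple_in_lattice[OF number_field order_submodule order_span, of "t0 * y"]
    by (metis mem_Collect_eq scale_mult_right)
  ultimately obtain F :: nat where F: "F > 0"
    "\<And>y. y \<in> I \<Longrightarrow> t0 * scale (of_nat F) y \<in> \<O>"
    using common_integer_denominator[OF fg] by (metis mem_Collect_eq)
  \<comment> \<open>The factor \<open>F\<close> ensures \<open>t I \<subseteq> \<O>\<close>.\<close>
  define t where "t = scale (of_nat F) t0"
  have t: "t \<noteq> 0" "\<sigma> t = t" "\<sigma> (t * x) = t * x"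
    using t0 F(1) by (simp_all add: t_def r scale_mult_left)
  define J where "J = (*) t ` I"
  have JO: "J \<subseteq> \<O>" using F(2) by (auto simp: J_def t_def scale_mult_left scale_mult_right)
  have J: "integral_submodule J"
    unfolding integral_submodule_def J_def
    using ID by (auto simp: image_iff scale_mult_right[symmetric] distrib_left[symmetric] intro: bexI[of _ 0])
  note JD = integral_submoduleD[OF J]
  have Jmult: "y * u \<in> J" if "y \<in> J" "u \<in> \<O>" for y u
    using that IO by (auto simp: J_def mult.assoc)
  obtain ti where ti: "t * ti = 1" using inverse_exists[OF t(1)] by blast
  obtain L :: nat where L: "L > 0" "scale (of_nat L) ti \<in> I"
    by (rule integer_multiple_in_lattice[OF number_field I' span])
  have LJ: "scale (of_nat L) 1 \<in> J"
    using L(2) ti by (auto simp: J_def scale_mult_right intro!: image_eqI[of _ _ "scale (of_nat L) ti"])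
  define x1 x2 where "x1 = t * scale (of_nat E) 1" and "x2 = t * x"
  have x12: "x1 \<in> J" "x2 \<in> J" using E(2) x(1) by (auto simp: x1_def x2_def J_def)
  have g1: "scale (of_nat m) y \<in> principal_plus \<O> L J x1" if "y \<in> J" for y
  proof -
    obtain z where z: "z \<in> I" "y = t * z" using \<open>y \<in> J\<close> by (auto simp: J_def)
    have "scale (of_nat m) y = x1 * scale (of_nat D) z + scale (of_nat L) 0"
      by (simp add: z(2) x1_def m_def scale_mult_left scale_mult_right)
    then show ?thesis using D(2)[OF z(1)] JD(1) by (rule principal_plusI[rotated 2])
  qed
  have g2: "scale (1 - of_nat m ^ k) y \<in> principal_plus \<O> L J x2" if "y \<in> J" for y
  proof -
    obtain z where z: "z \<in> I" "y = t * z" using \<open>y \<in> J\<close> by (auto simp: J_def)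
    obtain u where u: "u \<in> \<O>" "scale (1 - of_nat m ^ k) z = x * u"
      using kx[OF z(1)] unfolding principal_plus_def by auto
    have "scale (1 - of_nat m ^ k) y = t * scale (1 - of_nat m ^ k) z"
      by (simp add: z(2) scale_mult_right)
    then have "scale (1 - of_nat m ^ k) y = x2 * u + scale (of_nat L) 0"
      by (simp add: u(2) x2_def mult.assoc)
    then show ?thesis using u(1) JD(1) by (rule principal_plusI[rotated 2])
  qed
  obtain e l where e: "algebraic_int e" and s0: "scale e x1 + scale (1 - e) x2 \<in> J"
    and l: "\<And>y. y \<in> J \<Longrightarrow> scale (of_nat m ^ l) y
        \<in> principal_plus \<O> L J (scale e x1 + scale (1 - e) x2)"
    and kl: "\<And>y. y \<in> J \<Longrightarrow> scale (1 - of_nat m ^ k) y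
        \<in> principal_plus \<O> L J (scale e x1 + scale (1 - e) x2)"
    using glue_generators[OF order_submodule J Jmult L(1) algebraic_int_of_nat x12 g1 g2] by metis
  define s where "s = scale e x1 + scale (1 - e) x2"
  note s0 = s0[folded s_def] and l = l[folded s_def] and kl = kl[folded s_def]
  note PD = integral_submoduleD[OF integral_submodule_principal_plus[OF order_submodule J, of L s]]
  have mp: "algebraic_int (of_nat m ^ n :: 'k)" for n by (intro algebraic_int_power) auto
  \<comment> \<open>\<open>m\<^sup>l\<close> and \<open>1 - m\<^sup>k\<close> generate the unit ideal: \<open>1 - m\<^sup>k\<close> divides \<open>1 - m\<^sup>k\<^sup>l\<close>, and \<open>m\<^sup>l\<close> divides \<open>m\<^sup>k\<^sup>l\<close>.\<close>
  have "y - scale (of_nat m ^ (k * n)) y \<in> principal_plus \<O> L J s" if "y \<in> J" for y n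
  proof (induction n)
    case 0
    then show ?case using PD(1) by simp
  next
    case (Suc n)
    have "y - scale (of_nat m ^ (k * Suc n)) y = (y - scale (of_nat m ^ (k * n)) y)
        + scale (of_nat m ^ (k * n)) (scale (1 - of_nat m ^ k) y)"
      by (simp add: power_add right_diff_distrib scale_left_diff_distrib scale_right_diff_distrib
          mult.commute)
    also have "\<dots> \<in> principal_plus \<O> L J s"
      by (intro PD(2) PD(3)[OF mp] Suc kl[OF that])
    finally show ?case .
  qed
  moreover have "scale (of_nat m ^ (k * l)) y \<in> principal_plus \<O> L J s" if "y \<in> J" for y
  proof -
    have "k * l = l + (k - 1) * l" using k by (cases k) auto
    then have "scale (of_nat m ^ (k * l)) y = scale (of_nat m ^ ((k - 1) * l)) (scale (of_nat m ^ l) y)"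
      by (simp add: power_add mult.commute)
    then show ?thesis using PD(3)[OF mp l[OF that]] by (simp only:)
  qed
  ultimately have "y - scale (of_nat m ^ (k * l)) y + scale (of_nat m ^ (k * l)) y
      \<in> principal_plus \<O> L J s" if "y \<in> J" for y
    using PD(2) that by blast
  then have Jsub: "J \<subseteq> principal_plus \<O> L J s" by auto
  have "J = {s * u + scale (of_nat L) 1 * v | u v. u \<in> \<O> \<and> v \<in> \<O>}"
  proof (intro equalityI subsetI)
    fix y assume "y \<in> J"
    then obtain u z where "u \<in> \<O>" "z \<in> J" "y = s * u + scale (of_nat L) z"
      using Jsub unfolding principal_plus_def by blast
    then show "y \<in> {s * u + scale (of_nat L) 1 * v | u v. u \<in> \<O> \<and> v \<in> \<O>}"
      using JO by (auto simp: scale_mult_left)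
  next
    fix y assume "y \<in> {s * u + scale (of_nat L) 1 * v | u v. u \<in> \<O> \<and> v \<in> \<O>}"
    then show "y \<in> J" using JD(2) Jmult s0 LJ by blast
  qed
  moreover have "\<sigma> s = s"
    using t by (simp add: s_def x1_def x2_def r scale_mult_right)
  ultimately show ?thesis using that[of t s L] t(1) s0 JO L(1) unfolding J_def by blast
qed

end


section \<open>The twisted Euclidean algorithm\<close>

text \<open>
  Each division step replaces \<open>(a, b)\<close> by \<open>(b, a - b q)\<close>. It does not change \<open>a \<O> + b \<O>\<close>, and
  \<open>b \<sigma>(a - b q) = b \<sigma>(a) - b q \<sigma>(b)\<close> is again symmetric.
\<close>

lemma sigma_Euclidean_two_generators:
  assumes E: "sigma_Euclidean TYPE('w) \<O> \<sigma>"
    and sub: "\<And>x y. x \<in> \<O> \<Longrightarrow> y \<in> \<O> \<Longrightarrow> x + y \<in> \<O>" "\<And>x y. x \<in> \<O> \<Longrightarrow> y \<in> \<O> \<Longrightarrow> x - y \<in> \<O>"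
      "\<And>x y. x \<in> \<O> \<Longrightarrow> y \<in> \<O> \<Longrightarrow> x * y \<in> \<O>" "0 \<in> \<O>"
    and ab: "a \<in> \<O>" "b \<in> \<O>" "a * \<sigma> b \<in> symmetric_elements \<O> \<sigma>"
  obtains g where "g \<in> \<O>" "{a * u + b * v | u v. u \<in> \<O> \<and> v \<in> \<O>} = (*) g ` \<O>"
proof -
  have inv: "\<sigma> x \<in> \<O>" "\<sigma> (x + y) = \<sigma> x + \<sigma> y" "\<sigma> (x * y) = \<sigma> y * \<sigma> x" "\<sigma> (\<sigma> x) = x"
    if "x \<in> \<O>" "y \<in> \<O>" for x y
    using E that unfolding sigma_Euclidean_def involution_on_def by auto
  have inv_diff: "\<sigma> (x - y) = \<sigma> x - \<sigma> y" if "x \<in> \<O>" "y \<in> \<O>" for x y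
    using inv(2)[of "x - y" y] that sub by (simp add: algebra_simps)
  obtain W :: "'w set" and le \<Phi> where W: "well_order_on W le" and
    div: "\<And>a b. a \<in> \<O> \<Longrightarrow> b \<in> \<O> \<Longrightarrow> b \<noteq> 0 \<Longrightarrow> a * \<sigma> b \<in> symmetric_elements \<O> \<sigma> \<Longrightarrow>
      \<exists>q\<in>symmetric_elements \<O> \<sigma>. (\<Phi> (a - b * q), \<Phi> b) \<in> le - Id"
    using E unfolding sigma_Euclidean_def by metis
  have "wf (le - Id)" using W by (simp add: well_order_on_def)
  then have "wf (inv_image (le - Id) \<Phi>)" by (rule wf_inv_image)
  then have "\<exists>g\<in>\<O>. {a * u + b * v | u v. u \<in> \<O> \<and> v \<in> \<O>} = (*) g ` \<O>" using ab
  proof (induction b arbitrary: a rule: wf_induct_rule)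
    case (less b)
    show ?case
    proof (cases "b = 0")
      case True
      then show ?thesis using less.prems sub(4) by (intro bexI[of _ a]) (auto simp: image_iff)
    next
      case False
      then obtain q where q: "q \<in> \<O>" "\<sigma> q = q" "(a - b * q, b) \<in> inv_image (le - Id) \<Phi>"
        using div[OF less.prems(1,2) _ less.prems(3)] by (auto simp: symmetric_elements_def)
      define c where "c = a - b * q"
      have c: "c \<in> \<O>" using sub q less.prems by (simp add: c_def)
      have "\<sigma> (a * \<sigma> b) = b * \<sigma> a" "\<sigma> (a * \<sigma> b) = a * \<sigma> b"
        using less.prems inv by (auto simp: symmetric_elements_def)
      then have ba: "b * \<sigma> a = a * \<sigma> b" by simp
      have "b * \<sigma> c = b * \<sigma> a - b * q * \<sigma> b"
        using less.prems q sub by (simp add: c_def inv_diff inv(3) right_diff_distrib mult.assoc)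
      then have bc: "b * \<sigma> c = c * \<sigma> b" by (simp add: ba c_def left_diff_distrib)
      have "\<sigma> (b * \<sigma> c) = c * \<sigma> b" using less.prems c inv by simp
      then have "b * \<sigma> c \<in> symmetric_elements \<O> \<sigma>"
        using bc less.prems c sub inv by (simp add: symmetric_elements_def)
      then obtain g where g: "g \<in> \<O>" "{b * u + c * v | u v. u \<in> \<O> \<and> v \<in> \<O>} = (*) g ` \<O>"
        using less.IH[of c b] q(3) c less.prems unfolding c_def by blast
      have "{a * u + b * v | u v. u \<in> \<O> \<and> v \<in> \<O>} = {b * u + c * v | u v. u \<in> \<O> \<and> v \<in> \<O>}"
      proof (intro equalityI subsetI)
        fix y assume "y \<in> {a * u + b * v | u v. u \<in> \<O> \<and> v \<in> \<O>}"
        then obtain u v where uv: "u \<in> \<O>" "v \<in> \<O>" "y = a * u + b * v" by blast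
        then have "y = b * (q * u + v) + c * u" by (simp add: c_def algebra_simps)
        moreover have "q * u + v \<in> \<O>" using uv sub q(1) by simp
        ultimately show "y \<in> {b * u + c * v | u v. u \<in> \<O> \<and> v \<in> \<O>}" using uv(1) by blast
      next
        fix y assume "y \<in> {b * u + c * v | u v. u \<in> \<O> \<and> v \<in> \<O>}"
        then obtain u v where uv: "u \<in> \<O>" "v \<in> \<O>" "y = b * u + c * v" by blast
        then have "y = a * v + b * (u - q * v)" by (simp add: c_def algebra_simps)
        moreover have "u - q * v \<in> \<O>" using uv sub q(1) by simp
        ultimately show "y \<in> {a * u + b * v | u v. u \<in> \<O> \<and> v \<in> \<O>}" using uv(2) by blast
      qed
      then show ?thesis using g by metis
    qed
  qed
  then show ?thesis using that by blast
qed

theorem theorem1p1: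
  fixes scale :: "'k::field_char_0 \<Rightarrow> 'h::ring_1 \<Rightarrow> 'h"
    and a b :: 'k and i j :: 'h
    and \<sigma> :: "'h \<Rightarrow> 'h" and \<O> :: "'h set"
  assumes "number_field TYPE('k)"
    and "quaternion_algebra scale a b i j"
    and "orthogonal_involution scale i j \<sigma>"
    and "quaternion_order scale \<O>"
    and "sigma_Euclidean TYPE('w) \<O> \<sigma>"
  shows "right_class_number scale \<O> = 1"
proof -
  interpret quaternion_algebra scale a b i j by (rule assms(2))
  interpret quaternion_domain scale a b i j \<O>
    using assms(1,4,5) unfolding sigma_Euclidean_def by unfold_locales blast+
  note r = orthogonal_involution_rules[OF assms(3)]
  note OD = integral_submoduleD[OF order_submodule]
  define \<I> where "\<I> = invertible_right_ideals scale \<O>"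
  have principal: "\<exists>g. g \<noteq> 0 \<and> I = (*) g ` \<O>" if "I \<in> \<I>" for I
  proof -
    have I: "right_fractional_ideal scale \<O> I" "locally_principal scale \<O> I"
      using that unfolding \<I>_def invertible_right_ideals_def by auto
    obtain t s and n :: nat where t: "t \<noteq> 0" and s: "s \<in> \<O>" "\<sigma> s = s" and n: "n > 0"
      and tI: "(*) t ` I = {s * u + scale (of_nat n) 1 * v | u v. u \<in> \<O> \<and> v \<in> \<O>}"
      by (rule symmetric_two_generators[OF assms(3) I])
    have nO: "scale (of_nat n) 1 \<in> \<O>" using OD(3) order_one by simp
    have "s * \<sigma> (scale (of_nat n) 1) = scale (of_nat n) s"
      by (simp add: r scale_mult_right)
    then have "s * \<sigma> (scale (of_nat n) 1) \<in> symmetric_elements \<O> \<sigma>"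
      using s OD(3) by (simp add: symmetric_elements_def r)
    then obtain g where g: "(*) t ` I = (*) g ` \<O>"
      using sigma_Euclidean_two_generators[OF assms(5) OD(2,4) order_mult OD(1) s(1) nO] tI by metis
    obtain t' where t': "t' * t = 1" using inverse_exists[OF t] by blast
    have "I = (*) t' ` ((*) t ` I)"
      by (simp add: image_image mult.assoc[symmetric] t')
    then have I_eq: "I = (*) (t' * g) ` \<O>" by (simp add: g image_image mult.assoc)
    have "t' * g \<noteq> 0"
    proof
      assume "t' * g = 0"
      then have "I \<subseteq> {0}" using I_eq by auto
      moreover have "span I = UNIV" using I(1) unfolding right_fractional_ideal_def by blast
      ultimately have "(1 :: 'h) \<in> {0}" using span_mono[of I "{0}"] by (metis UNIV_I span_delete_0 span_empty Diff_cancel subsetD)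
      then show False by simp
    qed
    then show ?thesis using I_eq by blast
  qed
  have "\<O> \<in> \<I>"
    unfolding \<I>_def invertible_right_ideals_def right_fractional_ideal_def locally_principal_def
    using order_fin_gen order_span order_mult nonzero_is_unit[of 1] by (auto intro!: bexI[of _ 1])
  have "right_ideal_equiv scale \<O> = \<I> \<times> \<I>"
  proof -
    have "\<exists>\<alpha>\<in>Units ring_of_type_algebra. (*) \<alpha> ` I = J" if IJ: "I \<in> \<I>" "J \<in> \<I>" for I J
    proof -
      obtain g h where gh: "g \<noteq> 0" "I = (*) g ` \<O>" "h \<noteq> 0" "J = (*) h ` \<O>"
        using principal IJ by metis
      obtain g' where g': "g * g' = 1" "g' * g = 1" using inverse_exists[OF gh(1)] by blast
      have "h * g' \<noteq> 0" using no_zero_divisors[of h g'] gh(3) g' by auto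
      moreover have "(*) (h * g') ` I = J"
        unfolding gh image_image by (simp add: mult.assoc, simp add: mult.assoc[symmetric] g')
      ultimately show ?thesis using nonzero_is_unit by blast
    qed
    then show ?thesis unfolding right_ideal_equiv_def \<I>_def[symmetric] by auto
  qed
  then have "\<I> // right_ideal_equiv scale \<O> = {\<I>}"
    using \<open>\<O> \<in> \<I>\<close> by (auto simp: quotient_def)
  then show ?thesis unfolding right_class_number_def \<I>_def[symmetric] by simp
qed

end
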